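(* Let $x>0$. There is a Trimming Oracle implementing Reduce-Fastest$(x)$ that, on Bamboo Garden Trimming instances with $n$ bamboos, uses $O(n)$ space, can be built in $O(n\log n)$ time, and can report the next bamboo to trim in $O(\log n)$ worst-case time.
   Context: Bamboo Garden Trimming (BGT) problem: a garden contains $n$ bamboos $b_1,\dots,b_n$; bamboo $b_i$ has daily growth rate $h_i>0$, with $h_1\ge\dots\ge h_n$ and $\sum_{i=1}^n h_i=1$. Initially all heights are $0$. At the end of each day at most one bamboo is trimmed, which instantaneously resets its height to $0$. Days are indexed from $0$: the height of $b_i$ at the end of day $D$, before trimming, is $h_i$ times the number of days elapsed since the last day in which $b_i$ was trimmed, or $(D+1)h_i$ if $b_i$ was never trimmed before day $D$. Reduce-Fastest$(x)$: at the end of each day, trim the bamboo with the fastest daily growth rate among those whose height is at least $x$ (ties are broken in favour of the bamboo with the smallest index); if no bamboo has height at least $x$, no bamboo is trimmed that day. Trimming Oracle: a data structure that is built once from the input growth rates (given in arbitrary order) and is then queried once per day, perpetually, for days $0,1,2,\dots$; the query of day $D$ returns the bamboo to trim at the end of day $D$ (or "do nothing"). It implements a strategy if the infinite sequence of answers is exactly a schedule produced by that strategy. Space is the maximum number of memory words ever used, at any time during the infinite sequence of queries. The computational model is the word RAM with unit-cost arithmetic on numbers fitting in $O(1)$ memory words; it is assumed that $n$, $x$, the growth rates $h_i$ and the value $x/h_n$ (where $h_n$ is the smallest rate) each fit in a constant number of memory words (the day index $D$ itself is unbounded and is not assumed to fit). *)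

theory Defs
  imports "HOL-Library.Landau_Symbols"
begin

section \<open>Bamboo Garden Trimming\<close>

text \<open>
  Bamboos are numbered \<open>0, \<dots>, n - 1\<close> in the order in which their growth rates are given.
  This order is arbitrary: no monotonicity of \<open>h\<close> is assumed.
\<close>

definition bgt_instance :: "nat \<Rightarrow> (nat \<Rightarrow> real) \<Rightarrow> bool" where
  "bgt_instance n h \<longleftrightarrow> (\<forall>i<n. 0 < h i) \<and> (\<Sum>i<n. h i) = 1"

text \<open>\<open>trim D\<close> is the bamboo trimmed at the end of day \<open>D\<close>, if any.\<close>

type_synonym schedule = "nat \<Rightarrow> nat option"

text \<open>Height of bamboo \<open>i\<close> at the end of day \<open>D\<close>, before trimming.\<close>

definition height :: "(nat \<Rightarrow> real) \<Rightarrow> schedule \<Rightarrow> nat \<Rightarrow> nat \<Rightarrow> real" where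
  "height h trim D i =
     (if \<exists>d<D. trim d = Some i
      then h i * real (D - Max {d. d < D \<and> trim d = Some i})
      else h i * real (D + 1))"

text \<open>
  A fastest bamboo among those whose height in \<open>ht\<close> is at least \<open>x\<close>; ties are broken in favour of
  the smallest position in the input, which for non-increasing \<open>h\<close> is the smallest index.
\<close>

definition fastest_choice ::
  "nat \<Rightarrow> (nat \<Rightarrow> real) \<Rightarrow> real \<Rightarrow> (nat \<Rightarrow> real) \<Rightarrow> nat option" where
  "fastest_choice n h x ht =
     (if \<exists>i<n. x \<le> ht i
      then Some (LEAST i. i < n \<and> x \<le> ht i \<and> (\<forall>j<n. x \<le> ht j \<longrightarrow> h j \<le> h i))
      else None)"

definition reduce_fastest :: "nat \<Rightarrow> (nat \<Rightarrow> real) \<Rightarrow> real \<Rightarrow> schedule \<Rightarrow> bool" where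
  "reduce_fastest n h x trim \<longleftrightarrow> (\<forall>D. trim D = fastest_choice n h x (height h trim D))"

lemma fastest_choice_sorted:
  assumes "\<forall>i<n. \<forall>j<n. i \<le> j \<longrightarrow> h j \<le> h i" and "\<exists>i<n. x \<le> ht i"
  shows "fastest_choice n h x ht = Some (LEAST i. i < n \<and> x \<le> ht i)"
proof -
  let ?m = "LEAST i. i < n \<and> x \<le> ht i"
  have m: "?m < n \<and> x \<le> ht ?m"
    using assms(2) by (metis (mono_tags, lifting) LeastI)
  have le: "?m \<le> j" if "j < n" "x \<le> ht j" for j
    using that by (simp add: Least_le)
  have "(LEAST i. i < n \<and> x \<le> ht i \<and> (\<forall>j<n. x \<le> ht j \<longrightarrow> h j \<le> h i)) = ?m"
    by (rule Least_equality) (use m le assms(1) in auto)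
  then show ?thesis
    using assms(2) by (simp add: fastest_choice_def)
qed


section \<open>Word RAM\<close>

text \<open>
  A random access machine whose registers and memory cells hold numbers below \<open>2 ^ W\<close>; every instruction takes one
  time unit. With \<open>w\<close>-bit memory words, unit-cost arithmetic on numbers of \<open>K = O(1)\<close> words is
  obtained with \<open>W = K * w\<close>; each register and each cell then counts as \<open>K\<close> memory words.
\<close>

datatype arith = Add | Sub | Mul | Div | Mod

text \<open>The first argument of register-valued instructions is the destination register.\<close>

datatype instr =
    Const nat nat
  | Arith arith nat nat nat
  | Load nat nat         \<comment> \<open>destination register, register holding the address\<close>
  | Store nat nat        \<comment> \<open>register holding the address, source register\<close>
  | Jump nat
  | JumpLess nat nat nat \<comment> \<open>jump to the last argument if the first register is smaller\<close>

type_synonym prog = "instr list"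

record config =
  pc :: nat
  regs :: "nat \<Rightarrow> nat"
  mem :: "nat \<Rightarrow> nat"

fun arith_op :: "nat \<Rightarrow> arith \<Rightarrow> nat \<Rightarrow> nat \<Rightarrow> nat" where
  "arith_op W Add a b = (a + b) mod 2 ^ W"
| "arith_op W Sub a b = (a + (2 ^ W - b)) mod 2 ^ W"
| "arith_op W Mul a b = (a * b) mod 2 ^ W"
| "arith_op W Div a b = a div b"
| "arith_op W Mod a b = a mod b"

fun exec_instr :: "nat \<Rightarrow> instr \<Rightarrow> config \<Rightarrow> config" where
  "exec_instr W (Const r k) s =
     s\<lparr>pc := Suc (pc s), regs := (regs s)(r := k mod 2 ^ W)\<rparr>"
| "exec_instr W (Arith f r a b) s =
     s\<lparr>pc := Suc (pc s), regs := (regs s)(r := arith_op W f (regs s a) (regs s b))\<rparr>"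
| "exec_instr W (Load r a) s =
     s\<lparr>pc := Suc (pc s), regs := (regs s)(r := mem s (regs s a))\<rparr>"
| "exec_instr W (Store a r) s =
     s\<lparr>pc := Suc (pc s), mem := (mem s)(regs s a := regs s r)\<rparr>"
| "exec_instr W (Jump l) s = s\<lparr>pc := l\<rparr>"
| "exec_instr W (JumpLess a b l) s =
     s\<lparr>pc := (if regs s a < regs s b then l else Suc (pc s))\<rparr>"

definition halted :: "prog \<Rightarrow> config \<Rightarrow> bool" where
  "halted P s \<longleftrightarrow> length P \<le> pc s"

definition step :: "nat \<Rightarrow> prog \<Rightarrow> config \<Rightarrow> config" where
  "step W P s = (if halted P s then s else exec_instr W (P ! pc s) s)"

text \<open>The configuration after \<open>t\<close> steps, when \<open>P\<close> is started on the registers and memory of \<open>s\<close>.\<close>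

definition config_at :: "nat \<Rightarrow> prog \<Rightarrow> config \<Rightarrow> nat \<Rightarrow> config" where
  "config_at W P s t = (step W P ^^ t) (s\<lparr>pc := 0\<rparr>)"

text \<open>Started on \<open>s\<close>, program \<open>P\<close> halts after exactly \<open>t\<close> steps, in configuration \<open>s'\<close>.\<close>

definition runs :: "nat \<Rightarrow> prog \<Rightarrow> config \<Rightarrow> nat \<Rightarrow> config \<Rightarrow> bool" where
  "runs W P s t s' \<longleftrightarrow>
     (\<forall>k<t. \<not> halted P (config_at W P s k)) \<and> halted P (config_at W P s t) \<and>
     s' = config_at W P s t"

fun instr_cells :: "instr \<Rightarrow> config \<Rightarrow> nat set" where
  "instr_cells (Load r a) s = {regs s a}"
| "instr_cells (Store a r) s = {regs s a}"
| "instr_cells _ s = {}"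

definition accessed_cells :: "nat \<Rightarrow> prog \<Rightarrow> config \<Rightarrow> nat \<Rightarrow> nat set" where
  "accessed_cells W P s t =
     (\<Union>k<t. instr_cells (P ! pc (config_at W P s k)) (config_at W P s k))"

fun instr_regs :: "instr \<Rightarrow> nat set" where
  "instr_regs (Const r k) = {r}"
| "instr_regs (Arith f r a b) = {r, a, b}"
| "instr_regs (Load r a) = {r, a}"
| "instr_regs (Store a r) = {a, r}"
| "instr_regs (Jump l) = {}"
| "instr_regs (JumpLess a b l) = {a, b}"

definition prog_regs :: "prog \<Rightarrow> nat set" where
  "prog_regs P = (\<Union>i\<in>set P. instr_regs i)"


section \<open>Trimming Oracles\<close>

text \<open>
  The pair \<open>(p, q)\<close> represents the number \<open>r = p / q\<close>, with \<open>p\<close> and \<open>q\<close> of at most \<open>m\<close> bits.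
  It need not be in lowest terms.
\<close>

definition represents :: "nat \<Rightarrow> nat \<times> nat \<Rightarrow> real \<Rightarrow> bool" where
  "represents m e r \<longleftrightarrow>
     fst e < 2 ^ m \<and> 0 < snd e \<and> snd e < 2 ^ m \<and> r = real (fst e) / real (snd e)"

definition fits :: "nat \<Rightarrow> real \<Rightarrow> bool" where
  "fits m r \<longleftrightarrow> (\<exists>e. represents m e r)"

definition input_cells :: "nat \<Rightarrow> nat \<times> nat \<Rightarrow> (nat \<Rightarrow> nat \<times> nat) \<Rightarrow> nat list" where
  "input_cells n ex eh =
     [n, fst ex, snd ex] @ concat (map (\<lambda>i. [fst (eh i), snd (eh i)]) [0..<n])"

definition initial_config :: "nat list \<Rightarrow> config" where
  "initial_config xs =
     \<lparr>pc = 0, regs = (\<lambda>_. 0), mem = (\<lambda>a. if a < length xs then xs ! a else 0)\<rparr>"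

text \<open>
  The answer to a query is left in register 0: \<open>0\<close> for ``do nothing'', \<open>i + 1\<close> for bamboo \<open>i\<close>.
\<close>

definition answer :: "config \<Rightarrow> nat option" where
  "answer s = (if regs s 0 = 0 then None else Some (regs s 0 - 1))"

text \<open>
  The infinite run of an oracle: the build program turns the input configuration \<open>s0\<close> into \<open>s 0\<close>
  in \<open>tb\<close> steps, and the query of day \<open>D\<close> turns \<open>s D\<close> into \<open>s (Suc D)\<close> in \<open>tq D\<close> steps. Nothing is
  passed to a query other than the registers and memory left by its predecessor.
\<close>

definition oracle_run ::
  "nat \<Rightarrow> prog \<Rightarrow> prog \<Rightarrow> config \<Rightarrow> nat \<Rightarrow> (nat \<Rightarrow> nat) \<Rightarrow> (nat \<Rightarrow> config) \<Rightarrow> bool" where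
  "oracle_run W build query s0 tb tq s \<longleftrightarrow>
     runs W build s0 tb (s 0) \<and> (\<forall>D. runs W query (s D) (tq D) (s (Suc D)))"

definition oracle_schedule :: "(nat \<Rightarrow> config) \<Rightarrow> schedule" where
  "oracle_schedule s D = answer (s (Suc D))"

text \<open>All memory cells accessed during the infinite run.\<close>

definition oracle_cells ::
  "nat \<Rightarrow> prog \<Rightarrow> prog \<Rightarrow> config \<Rightarrow> nat \<Rightarrow> (nat \<Rightarrow> nat) \<Rightarrow> (nat \<Rightarrow> config) \<Rightarrow> nat set" where
  "oracle_cells W build query s0 tb tq s =
     accessed_cells W build s0 tb \<union> (\<Union>D. accessed_cells W query (s D) (tq D))"

text \<open>
  The registers together with a memory segment \<open>{..<m}\<close> that contains the input and every cell
  in \<open>cells\<close> take at most \<open>b\<close> memory words, at \<open>K\<close> words per register or cell.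
\<close>

definition space_at_most ::
  "nat \<Rightarrow> prog \<Rightarrow> prog \<Rightarrow> nat list \<Rightarrow> nat set \<Rightarrow> real \<Rightarrow> bool" where
  "space_at_most K build query inp cells b \<longleftrightarrow>
     (\<exists>m. {..<length inp} \<union> cells \<subseteq> {..<m} \<and>
          real (K * (card (insert 0 (prog_regs build \<union> prog_regs query)) + m)) \<le> b)"

text \<open>
  On the given input, the pair of programs is a Trimming Oracle that implements
  Reduce-Fastest\<open>(x)\<close> within space \<open>S\<close>, building time \<open>B\<close> and worst-case query time \<open>Q\<close>.
\<close>

definition implements_reduce_fastest ::
  "nat \<Rightarrow> nat \<Rightarrow> prog \<Rightarrow> prog \<Rightarrow> nat \<Rightarrow> (nat \<Rightarrow> real) \<Rightarrow> real \<Rightarrow> nat list \<Rightarrow>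
   real \<Rightarrow> real \<Rightarrow> real \<Rightarrow> bool" where
  "implements_reduce_fastest w K build query n h x inp S B Q \<longleftrightarrow>
     (\<exists>tb tq s.
        oracle_run (K * w) build query (initial_config inp) tb tq s \<and>
        reduce_fastest n h x (oracle_schedule s) \<and>
        space_at_most K build query inp
          (oracle_cells (K * w) build query (initial_config inp) tb tq s) S \<and>
        real tb \<le> B \<and> (\<forall>D. real (tq D) \<le> Q))"

end

theory Submission
  imports Defs "HOL-Real_Asymp.Real_Asymp"
begin

text \<open>
  Order the bamboos by decreasing rate, and keep over this order a complete binary tree whose
  leaf for a bamboo holds the first day on which it is tall enough and whose inner nodes hold
  minima. The bamboo to trim on day \<open>D\<close> is the leftmost leaf with value at most \<open>D\<close>; it is found by
  walking down the tree, and its new value is propagated by walking up. The day is unbounded, so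
  all values are kept modulo \<open>2 ^ W\<close>. This is sound as long as they lie in a short window around
  \<open>D\<close>, and only starving bamboos leave it; therefore each day one further leaf, in cyclic order,
  has its value raised to \<open>D\<close> if it is overdue. A tournament on the same tree sorts the bamboos.
\<close>

section \<open>Structured programs and timed weakest preconditions\<close>

text \<open>Residues can be compared only relative to a common origin: key minus day modulo
  \<open>2 ^ W\<close> is the true difference exactly while that difference lies in
  \<open>[0, 2 ^ W)\<close>. A key ahead of the day is harmless, since waiting times are bounded,
  but a bamboo that is ready and always preempted keeps its key while the day grows without limit.
  Keys are therefore stored with an added \<open>P\<close>: when a leaf becomes ready its key is
  still \<open>P\<close> ahead of the day, and a sweep of one leaf per day reaches it in time, at
  the price of one more path update. Raising a ready key to the threshold \<open>D + P\<close> loses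
  nothing, because the search only asks which leaves are ready; rates enter through the position of
  the leaves alone.

  A tournament compares single words, whereas a rate is a fraction that need not be in lowest terms.
  So the rates are turned into integers by a rounding fine enough to keep different fractions apart,
  and these integers are what needs the widest words.\<close>

datatype com =
    Block "instr list"
  | Seq com com
  | IfLess nat nat com com
  | WhileLess nat nat com

fun csize :: "com \<Rightarrow> nat" where
  "csize (Block is) = length is"
| "csize (Seq c d) = csize c + csize d"
| "csize (IfLess a b c d) = csize c + csize d + 2"
| "csize (WhileLess a b c) = csize c + 3"

text \<open>The first argument is the address at which the code is placed.\<close>

fun compile :: "nat \<Rightarrow> com \<Rightarrow> prog" where
  "compile l (Block is) = is"
| "compile l (Seq c d) = compile l c @ compile (l + csize c) d"
| "compile l (IfLess a b c d) =
     JumpLess a b (l + csize d + 2) # compile (l + 1) d @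
     Jump (l + csize d + 2 + csize c) # compile (l + csize d + 2) c"
| "compile l (WhileLess a b c) =
     JumpLess a b (l + 2) # Jump (l + csize c + 3) # compile (l + 2) c @ [Jump l]"

lemma length_compile [simp]: "length (compile l c) = csize c"
  by (induction c arbitrary: l) auto

text \<open>The bound on the accessed cells travels with the run because the space claim concerns
  every cell ever touched; the absence of earlier halting is what \<open>runs\<close> asks
  for.\<close>

definition reach :: "nat \<Rightarrow> prog \<Rightarrow> nat \<Rightarrow> nat \<Rightarrow> config \<Rightarrow> config \<Rightarrow> bool" where
  "reach W P M t s s' \<longleftrightarrow> (step W P ^^ t) s = s' \<and>
     (\<forall>k<t. \<not> halted P ((step W P ^^ k) s) \<and>
        instr_cells (P ! pc ((step W P ^^ k) s)) ((step W P ^^ k) s) \<subseteq> {..<M})"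

lemma reach_0: "reach W P M 0 s s"
  by (simp add: reach_def)

lemma reach_trans:
  assumes "reach W P M t s s'" "reach W P M u s' s''"
  shows "reach W P M (t + u) s s''"
  unfolding reach_def
proof (intro conjI allI impI)
  show "(step W P ^^ (t + u)) s = s''"
    using assms by (simp add: reach_def add.commute[of t] funpow_add)
next
  fix k assume k: "k < t + u"
  have "k < t \<or> (step W P ^^ k) s = (step W P ^^ (k - t)) s' \<and> k - t < u"
  proof (cases "k < t")
    case False
    then have "(step W P ^^ k) s = (step W P ^^ (k - t + t)) s" by simp
    also have "\<dots> = (step W P ^^ (k - t)) s'"
      using assms(1) by (simp only: funpow_add o_apply) (simp add: reach_def)
    finally show ?thesis using False k by simp
  qed simp
  then show "\<not> halted P ((step W P ^^ k) s)"
    and "instr_cells (P ! pc ((step W P ^^ k) s)) ((step W P ^^ k) s) \<subseteq> {..<M}"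
    using assms unfolding reach_def by metis+
qed

lemma reach_step:
  assumes "pc s < length P" "instr_cells (P ! pc s) s \<subseteq> {..<M}"
    "exec_instr W (P ! pc s) s = s'" "reach W P M t s' s''"
  shows "reach W P M (Suc t) s s''"
proof -
  have "reach W P M 1 s s'"
    using assms by (auto simp: reach_def halted_def step_def)
  from reach_trans[OF this assms(4)] show ?thesis by simp
qed

text \<open>
  Every run from \<open>(R, m)\<close> takes at most \<open>t\<close> steps, accesses only cells below \<open>M\<close> and ends in a
  state satisfying \<open>Q\<close>, wherever the code is placed.
\<close>

definition wp :: "nat \<Rightarrow> nat \<Rightarrow> com \<Rightarrow> nat \<Rightarrow> ((nat \<Rightarrow> nat) \<Rightarrow> (nat \<Rightarrow> nat) \<Rightarrow> bool) \<Rightarrow>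
    (nat \<Rightarrow> nat) \<Rightarrow> (nat \<Rightarrow> nat) \<Rightarrow> bool" where
  "wp W M c t Q R m \<longleftrightarrow> (\<forall>pre post. \<exists>t'\<le>t. \<exists>R' m'.
     reach W (pre @ compile (length pre) c @ post) M t'
       \<lparr>pc = length pre, regs = R, mem = m\<rparr>
       \<lparr>pc = length pre + csize c, regs = R', mem = m'\<rparr> \<and> Q R' m')"

lemma wpE:
  assumes "wp W M c t Q R m" "P = pre @ compile (length pre) c @ post"
  obtains t' R' m' where "t' \<le> t" "Q R' m'"
    "reach W P M t' \<lparr>pc = length pre, regs = R, mem = m\<rparr>
       \<lparr>pc = length pre + csize c, regs = R', mem = m'\<rparr>"
  using assms unfolding wp_def by blast

lemma wp_time:
  assumes "wp W M c t Q R m" "t \<le> t'"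
  shows "wp W M c t' Q R m"
  using assms unfolding wp_def by (meson order_trans)

text \<open>Jump targets are absolute, so \<open>d\<close> is run with the code of \<open>c\<close>
  counted as part of its prefix. This is why \<open>wp\<close> quantifies over the surrounding
  code.\<close>

lemma wp_seq_add:
  assumes "wp W M c t (\<lambda>R' m'. wp W M d u Q R' m') R m"
  shows "wp W M (Seq c d) (t + u) Q R m"
  unfolding wp_def
proof (intro allI)
  fix pre post
  let ?P = "pre @ compile (length pre) (Seq c d) @ post"
  have P1: "?P = pre @ compile (length pre) c @ (compile (length pre + csize c) d @ post)"
    by simp
  obtain t' R' m' where 1: "t' \<le> t" "wp W M d u Q R' m'"
    "reach W ?P M t' \<lparr>pc = length pre, regs = R, mem = m\<rparr>
       \<lparr>pc = length pre + csize c, regs = R', mem = m'\<rparr>"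
    using wpE[OF assms P1] .
  have P2: "?P = (pre @ compile (length pre) c) @
      compile (length (pre @ compile (length pre) c)) d @ post"
    by simp
  obtain u' R'' m'' where 2: "u' \<le> u" "Q R'' m''"
    "reach W ?P M u' \<lparr>pc = length (pre @ compile (length pre) c), regs = R', mem = m'\<rparr>
       \<lparr>pc = length (pre @ compile (length pre) c) + csize d, regs = R'', mem = m''\<rparr>"
    using wpE[OF 1(2) P2] .
  show "\<exists>t'\<le>t + u. \<exists>R' m'.
     reach W ?P M t' \<lparr>pc = length pre, regs = R, mem = m\<rparr>
       \<lparr>pc = length pre + csize (Seq c d), regs = R', mem = m'\<rparr> \<and> Q R' m'"
    using 1 2 reach_trans[OF 1(3), of u'] 
    by (intro exI[of _ "t' + u'"] conjI exI[of _ R''] exI[of _ m'']) (auto simp: add.assoc)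
qed

text \<open>Passing on the remaining budget \<open>u - t\<close> lets one total bound be threaded
  through a long composition; it is settled by arithmetic at the end.\<close>

lemma wp_seq:
  assumes "wp W M c t (\<lambda>R' m'. wp W M d (u - t) Q R' m') R m" "t \<le> u"
  shows "wp W M (Seq c d) u Q R m"
  using wp_seq_add[OF assms(1)] assms(2) by simp

text \<open>One step is the conditional jump; the other is the jump over the code of
  \<open>c\<close>, which is placed last and has to be skipped after \<open>d\<close>.\<close>

lemma wp_if_add:
  assumes "R a < R b \<Longrightarrow> wp W M c t Q R m" "\<not> R a < R b \<Longrightarrow> wp W M d t Q R m"
  shows "wp W M (IfLess a b c d) (t + 2) Q R m"
  unfolding wp_def
proof (intro allI)
  fix pre post
  let ?P = "pre @ compile (length pre) (IfLess a b c d) @ post"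
  let ?l = "length pre"
  have n0: "?P ! ?l = JumpLess a b (?l + csize d + 2)" "?l < length ?P" 
    by (simp_all add: nth_append)
  show "\<exists>t'\<le>t + 2. \<exists>R' m'.
     reach W ?P M t' \<lparr>pc = ?l, regs = R, mem = m\<rparr>
       \<lparr>pc = ?l + csize (IfLess a b c d), regs = R', mem = m'\<rparr> \<and> Q R' m'"
  proof (cases "R a < R b")
    case True
    define pre' where "pre' = pre @ JumpLess a b (?l + csize d + 2) # compile (?l + 1) d @
       [Jump (?l + csize d + 2 + csize c)]"
    have l: "length pre' = ?l + csize d + 2" by (simp add: pre'_def)
    have P: "?P = pre' @ compile (length pre') c @ post"
      unfolding l by (simp add: pre'_def)
    obtain t' R' m' where 1: "t' \<le> t" "Q R' m'"
      "reach W ?P M t' \<lparr>pc = length pre', regs = R, mem = m\<rparr>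
         \<lparr>pc = length pre' + csize c, regs = R', mem = m'\<rparr>"
      using wpE[OF assms(1)[OF True] P] .
    have "reach W ?P M (Suc t') \<lparr>pc = ?l, regs = R, mem = m\<rparr>
         \<lparr>pc = length pre' + csize c, regs = R', mem = m'\<rparr>"
      by (rule reach_step[OF _ _ _ 1(3)]) (use n0 True l in auto)
    then show ?thesis using 1 l
      by (intro exI[of _ "Suc t'"] conjI exI[of _ R'] exI[of _ m']) (auto simp: ac_simps)
  next
    case False
    define pre' where "pre' = pre @ [JumpLess a b (?l + csize d + 2)]"
    define post' where "post' = Jump (?l + csize d + 2 + csize c) # compile (?l + csize d + 2) c @ post"
    have l: "length pre' = ?l + 1" by (simp add: pre'_def)
    have P: "?P = pre' @ compile (length pre') d @ post'"
      unfolding l by (simp add: pre'_def post'_def)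
    obtain t' R' m' where 1: "t' \<le> t" "Q R' m'"
      "reach W ?P M t' \<lparr>pc = length pre', regs = R, mem = m\<rparr>
         \<lparr>pc = length pre' + csize d, regs = R', mem = m'\<rparr>"
      using wpE[OF assms(2)[OF False] P] .
    have 2: "reach W ?P M (Suc t') \<lparr>pc = ?l, regs = R, mem = m\<rparr>
         \<lparr>pc = length pre' + csize d, regs = R', mem = m'\<rparr>"
      by (rule reach_step[OF _ _ _ 1(3)]) (use n0 False l in auto)
    have n1: "?P ! (length pre' + csize d) = Jump (?l + csize d + 2 + csize c)"
      unfolding P post'_def by (simp add: nth_append)
    have n2: "length pre' + csize d < length ?P" by (simp add: l)
    have "reach W ?P M (Suc 0) \<lparr>pc = length pre' + csize d, regs = R', mem = m'\<rparr>
         \<lparr>pc = ?l + csize d + 2 + csize c, regs = R', mem = m'\<rparr>"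
      by (rule reach_step[OF _ _ _ reach_0]) (use n1 n2 in auto)
    from reach_trans[OF 2 this] show ?thesis using 1 l
      by (intro exI[of _ "Suc t' + Suc 0"] conjI exI[of _ R'] exI[of _ m']) (auto simp: ac_simps)
  qed
qed

lemma wp_if:
  assumes "R a < R b \<Longrightarrow> wp W M c (t - 2) Q R m" "\<not> R a < R b \<Longrightarrow> wp W M d (t - 2) Q R m"
    and "2 \<le> t"
  shows "wp W M (IfLess a b c d) t Q R m"
  using wp_if_add[of R a b W M c "t - 2" Q m d] assms by (simp del: add_2_eq_Suc')

text \<open>The index of the invariant counts the remaining iterations.\<close>

lemma wp_while:
  assumes step: "\<And>j R m. I (Suc j) R m \<Longrightarrow> R a < R b \<and> wp W M c t (I j) R m"
    and final: "\<And>R m. I 0 R m \<Longrightarrow> \<not> R a < R b \<and> Q R m"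
  shows "I j R m \<Longrightarrow> wp W M (WhileLess a b c) (j * (t + 2) + 2) Q R m"
proof (induction j arbitrary: R m)
  case 0
  then have nb: "\<not> R a < R b" and q: "Q R m" using final by auto
  show ?case unfolding wp_def
  proof (intro allI)
    fix pre post
    let ?P = "pre @ compile (length pre) (WhileLess a b c) @ post"
    let ?l = "length pre"
    have n0: "?P ! ?l = JumpLess a b (?l + 2)" "?P ! Suc ?l = Jump (?l + csize c + 3)"
      by (simp_all add: nth_append)
    \<comment> \<open>Leaving the loop costs two steps: the failing test and the exit jump behind
      it.\<close>
    have "reach W ?P M (Suc (Suc 0)) \<lparr>pc = ?l, regs = R, mem = m\<rparr>
       \<lparr>pc = ?l + csize c + 3, regs = R, mem = m\<rparr>"
      apply (rule reach_step[where s' = "\<lparr>pc = Suc ?l, regs = R, mem = m\<rparr>"])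
         apply (use n0 nb in simp_all)[3]
      apply (rule reach_step[OF _ _ _ reach_0])
        apply (use n0 in simp_all)
      done
    then show "\<exists>t'\<le>0 * (t + 2) + 2. \<exists>R' m'.
       reach W ?P M t' \<lparr>pc = ?l, regs = R, mem = m\<rparr>
         \<lparr>pc = ?l + csize (WhileLess a b c), regs = R', mem = m'\<rparr> \<and> Q R' m'"
      using q by (intro exI[of _ "Suc (Suc 0)"] conjI exI[of _ R] exI[of _ m]) (auto simp: ac_simps)
  qed
next
  case (Suc j)
  then have b: "R a < R b" and body: "wp W M c t (I j) R m" using step by auto
  show ?case unfolding wp_def
  proof (intro allI)
    fix pre post
    let ?P = "pre @ compile (length pre) (WhileLess a b c) @ post"
    let ?l = "length pre"
    define pre' where "pre' = pre @ [JumpLess a b (?l + 2), Jump (?l + csize c + 3)]"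
    have l: "length pre' = ?l + 2" by (simp add: pre'_def)
    have P: "?P = pre' @ compile (length pre') c @ (Jump ?l # post)"
      unfolding l by (simp add: pre'_def)
    have n0: "?P ! ?l = JumpLess a b (?l + 2)" "?P ! (?l + 2 + csize c) = Jump ?l"
      "?l < length ?P" "?l + 2 + csize c < length ?P"
      by (simp_all add: nth_append)
    obtain t' R' m' where 1: "t' \<le> t" "I j R' m'"
      "reach W ?P M t' \<lparr>pc = length pre', regs = R, mem = m\<rparr>
         \<lparr>pc = length pre' + csize c, regs = R', mem = m'\<rparr>"
      using wpE[OF body P] .
    have 2: "reach W ?P M (Suc t') \<lparr>pc = ?l, regs = R, mem = m\<rparr>
         \<lparr>pc = length pre' + csize c, regs = R', mem = m'\<rparr>"
      by (rule reach_step[OF _ _ _ 1(3)]) (use n0 b l in auto)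
    have 3: "reach W ?P M (Suc 0) \<lparr>pc = length pre' + csize c, regs = R', mem = m'\<rparr>
         \<lparr>pc = ?l, regs = R', mem = m'\<rparr>"
      by (rule reach_step[OF _ _ _ reach_0]) (use n0 l in auto)
    obtain u R'' m'' where 4: "u \<le> j * (t + 2) + 2" "Q R'' m''"
      "reach W ?P M u \<lparr>pc = ?l, regs = R', mem = m'\<rparr>
         \<lparr>pc = ?l + csize (WhileLess a b c), regs = R'', mem = m''\<rparr>"
      using wpE[OF Suc.IH[OF 1(2)] refl] .
    show "\<exists>t'\<le>Suc j * (t + 2) + 2. \<exists>R' m'.
       reach W ?P M t' \<lparr>pc = ?l, regs = R, mem = m\<rparr>
         \<lparr>pc = ?l + csize (WhileLess a b c), regs = R', mem = m'\<rparr> \<and> Q R' m'"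
      using reach_trans[OF reach_trans[OF 2 3] 4(3)] 1 4
      by (intro exI[of _ "Suc t' + Suc 0 + u"] conjI exI[of _ R''] exI[of _ m'']) auto
  qed
qed

text \<open>Straight-line code is executed symbolically by rewriting with these equations; every
  memory access leaves the obligation that its address is below \<open>M\<close>. Jumps are
  rejected, since their absolute targets would make a block depend on its position.\<close>

fun block_wp :: "nat \<Rightarrow> nat \<Rightarrow> instr list \<Rightarrow> ((nat \<Rightarrow> nat) \<Rightarrow> (nat \<Rightarrow> nat) \<Rightarrow> bool) \<Rightarrow>
    (nat \<Rightarrow> nat) \<Rightarrow> (nat \<Rightarrow> nat) \<Rightarrow> bool" where
  "block_wp W M [] Q R m = Q R m"
| "block_wp W M (Const r k # is) Q R m = block_wp W M is Q (R(r := k mod 2 ^ W)) m"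
| "block_wp W M (Arith f r a b # is) Q R m =
     block_wp W M is Q (R(r := arith_op W f (R a) (R b))) m"
| "block_wp W M (Load r a # is) Q R m = (R a < M \<and> block_wp W M is Q (R(r := m (R a))) m)"
| "block_wp W M (Store a r # is) Q R m = (R a < M \<and> block_wp W M is Q R (m(R a := R r)))"
| "block_wp W M (Jump l # is) Q R m = False"
| "block_wp W M (JumpLess a b l # is) Q R m = False"

lemma reach_block:
  assumes "block_wp W M is Q R m"
  shows "\<exists>R' m'. reach W (pre @ is @ post) M (length is) \<lparr>pc = length pre, regs = R, mem = m\<rparr>
       \<lparr>pc = length pre + length is, regs = R', mem = m'\<rparr> \<and> Q R' m'"
  using assms
proof (induction "is" arbitrary: pre R m)
  case Nil
  then show ?case using reach_0 by fastforce
next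
  case (Cons i "is")
  have eq: "(pre @ [i]) @ is @ post = pre @ (i # is) @ post" by simp
  have IH: "\<exists>R'' m''. reach W (pre @ (i # is) @ post) M (length is)
       \<lparr>pc = Suc (length pre), regs = R', mem = m'\<rparr>
       \<lparr>pc = length pre + length (i # is), regs = R'', mem = m''\<rparr> \<and> Q R'' m''"
    if "block_wp W M is Q R' m'" for R' m'
    using Cons.IH[OF that, of "pre @ [i]"] unfolding eq by simp
  have n: "(pre @ (i # is) @ post) ! length pre = i" by (simp add: nth_append)
  have "\<exists>R' m'. exec_instr W i \<lparr>pc = length pre, regs = R, mem = m\<rparr> =
       \<lparr>pc = Suc (length pre), regs = R', mem = m'\<rparr> \<and>
       instr_cells i \<lparr>pc = length pre, regs = R, mem = m\<rparr> \<subseteq> {..<M} \<and> block_wp W M is Q R' m'"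
    using Cons.prems by (cases i) auto
  then obtain R' m' where 1: "exec_instr W i \<lparr>pc = length pre, regs = R, mem = m\<rparr> =
       \<lparr>pc = Suc (length pre), regs = R', mem = m'\<rparr>"
    "instr_cells i \<lparr>pc = length pre, regs = R, mem = m\<rparr> \<subseteq> {..<M}" "block_wp W M is Q R' m'"
    by blast
  obtain R'' m'' where 2: "reach W (pre @ (i # is) @ post) M (length is)
       \<lparr>pc = Suc (length pre), regs = R', mem = m'\<rparr>
       \<lparr>pc = length pre + length (i # is), regs = R'', mem = m''\<rparr>" "Q R'' m''"
    using IH[OF 1(3)] by blast
  have "reach W (pre @ (i # is) @ post) M (Suc (length is)) \<lparr>pc = length pre, regs = R, mem = m\<rparr>
       \<lparr>pc = length pre + length (i # is), regs = R'', mem = m''\<rparr>"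
    by (rule reach_step[OF _ _ _ 2(1)]) (use 1 n in simp_all)
  then show ?case using 2 by auto
qed

lemma wp_block:
  assumes "block_wp W M is Q R m" "length is \<le> t"
  shows "wp W M (Block is) t Q R m"
  unfolding wp_def using reach_block[OF assms(1)] assms(2) by fastforce

lemma wp_block_seq:
  assumes "block_wp W M is (wp W M d (u - length is) Q) R m" "length is \<le> u"
  shows "wp W M (Seq (Block is) d) u Q R m"
  by (rule wp_seq[where t = "length is"]) (use assms wp_block in auto)

text \<open>Bridge to the machine model: with no surrounding code the end address of
  \<open>c\<close> is the length of the program, so the final state is halted.\<close>

lemma wp_runs:
  assumes "wp W M c t Q (regs s) (mem s)"
  obtains t' s' where "t' \<le> t" "runs W (compile 0 c) s t' s'" "Q (regs s') (mem s')"
    "accessed_cells W (compile 0 c) s t' \<subseteq> {..<M}"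
proof -
  let ?P = "compile 0 c"
  have P: "?P = [] @ compile (length []) c @ []" by simp
  obtain t' R' m' where 1: "t' \<le> t" "Q R' m'"
    "reach W ?P M t' \<lparr>pc = 0, regs = regs s, mem = mem s\<rparr>
       \<lparr>pc = csize c, regs = R', mem = m'\<rparr>"
    using wpE[OF assms P] by auto
  have s: "s\<lparr>pc := 0\<rparr> = \<lparr>pc = 0, regs = regs s, mem = mem s\<rparr>" by simp
  have at: "config_at W ?P s t' = \<lparr>pc = csize c, regs = R', mem = m'\<rparr>"
    using 1(3) by (simp add: config_at_def s reach_def)
  show thesis
  proof (rule that[OF 1(1), of "config_at W ?P s t'"])
    show "runs W ?P s t' (config_at W ?P s t')"
      unfolding runs_def at using 1(3)
      by (auto simp: config_at_def s reach_def halted_def)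
    show "Q (regs (config_at W ?P s t')) (mem (config_at W ?P s t'))"
      using 1(2) by (simp add: at)
    show "accessed_cells W ?P s t' \<subseteq> {..<M}"
      using 1(3) unfolding accessed_cells_def config_at_def s reach_def by blast
  qed
qed

section \<open>Tournament trees of keys modulo \<open>2 ^ W\<close>\<close>

text \<open>Heap numbering: the root is \<open>1\<close>, and the leaves are \<open>P, \<dots>, 2 * P - 1\<close>.\<close>

function tree_min :: "nat \<Rightarrow> (nat \<Rightarrow> nat) \<Rightarrow> nat \<Rightarrow> nat" where
  "tree_min P f k =
     (if k = 0 \<or> P \<le> k then f k else min (tree_min P f (2 * k)) (tree_min P f (2 * k + 1)))"
  by auto
termination by (relation "measure (\<lambda>(P, f, k). P - k)") auto

declare tree_min.simps [simp del]

lemma tree_min_leaf: "P \<le> k \<Longrightarrow> tree_min P f k = f k"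
  by (simp add: tree_min.simps)

lemma tree_min_node:
  "0 < k \<Longrightarrow> k < P \<Longrightarrow> tree_min P f k = min (tree_min P f (2 * k)) (tree_min P f (2 * k + 1))"
  by (subst tree_min.simps) simp

lemma tree_min_attained:
  "0 < k \<Longrightarrow> k < 2 * P \<Longrightarrow> \<exists>l\<in>{P..<2 * P}. tree_min P f k = f l"
proof (induction P f k rule: tree_min.induct)
  case (1 P f k)
  show ?case
  proof (cases "P \<le> k")
    case True
    then show ?thesis using 1 by (auto simp: tree_min_leaf)
  next
    case False
    then show ?thesis using 1 by (auto simp: tree_min_node min_def)
  qed
qed

text \<open>In heap numbering \<open>l div 2 ^ e\<close> is the \<open>e\<close>-th ancestor of the
  leaf \<open>l\<close>, and minima can only decrease on the way to the root.\<close>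

lemma tree_min_le:
  "l < 2 * P \<Longrightarrow> P \<le> l \<Longrightarrow> 0 < l div 2 ^ e \<Longrightarrow> tree_min P f (l div 2 ^ e) \<le> f l"
proof (induction e)
  case 0
  then show ?case by (simp add: tree_min_leaf)
next
  case (Suc e)
  let ?k = "l div 2 ^ e"
  have k: "l div 2 ^ Suc e = ?k div 2" by (simp only: power_Suc2 div_mult2_eq)
  have "?k \<le> l" by simp
  then have lt: "?k div 2 < P" "0 < ?k div 2" using Suc.prems unfolding k by linarith+
  have "?k = 2 * (?k div 2) \<or> ?k = 2 * (?k div 2) + 1" by linarith
  then have "tree_min P f (?k div 2) \<le> tree_min P f ?k"
    using tree_min_node[OF lt(2,1), of f] by (metis min.cobounded1 min.cobounded2)
  also have "\<dots> \<le> f l"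
    using Suc lt by (intro Suc.IH) auto
  finally show ?case unfolding k .
qed

text \<open>If a child of \<open>k\<close> were an ancestor of \<open>l\<close>, then
  \<open>k\<close> would be one too, namely with exponent \<open>e + 1\<close>; so the induction
  never meets the changed leaf.\<close>

lemma tree_min_upd:
  "0 < k \<Longrightarrow> (\<And>e. k \<noteq> l div 2 ^ e) \<Longrightarrow> tree_min P (f(l := v)) k = tree_min P f k"
proof (induction P f k rule: tree_min.induct)
  case (1 P f k)
  show ?case
  proof (cases "P \<le> k")
    case True
    have "k \<noteq> l" using 1(4)[of 0] by simp
    then show ?thesis using True by (auto simp: tree_min_leaf)
  next
    case False
    have "2 * k \<noteq> l div 2 ^ e" "2 * k + 1 \<noteq> l div 2 ^ e" for e
      using 1(4)[of "Suc e"] unfolding power_Suc2 div_mult2_eq by linarith+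
    then show ?thesis using 1 False by (auto simp: tree_min_node)
  qed
qed

lemma tree_min_window:
  assumes "\<forall>l\<in>{P..<2 * P}. D \<le> f l \<and> f l < D + N" "0 < k" "k < 2 * P"
  shows "D \<le> tree_min P f k" "tree_min P f k < D + N"
  using tree_min_attained[OF assms(2,3), of f] assms(1) by auto

text \<open>The key to an unbounded day counter: residues of \<open>a\<close> and \<open>D\<close>
  suffice to recover \<open>a - D\<close>, provided that \<open>a\<close> lies in the window of
  length \<open>N\<close> starting at \<open>D\<close>.\<close>

lemma sub_mod:
  fixes a D N :: nat
  assumes "D \<le> a" "a < D + N"
  shows "(a mod N + (N - D mod N)) mod N = a - D"
proof -
  define r where "r = D mod N"
  have r: "r \<le> N" using assms by (simp add: r_def less_imp_le)
  have "(a mod N + (N - r)) mod N = ((a - D + D) mod N + (N - r)) mod N"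
    using assms by simp
  also have "(a - D + D) mod N = (a - D + r) mod N"
    unfolding r_def by (rule mod_add_right_eq[symmetric])
  also have "((a - D + r) mod N + (N - r)) mod N = (a - D + r + (N - r)) mod N"
    by (rule mod_add_left_eq)
  also have "\<dots> = (a - D) mod N" using r by (simp add: add.assoc)
  finally show ?thesis using assms by (simp add: r_def)
qed

declare arith_op.simps(2) [simp del]

lemma arith_Sub_mod:
  assumes "D \<le> a" "a < D + 2 ^ W"
  shows "arith_op W Sub (a mod 2 ^ W) (D mod 2 ^ W) = a - D"
  using sub_mod[OF assms] by (simp add: arith_op.simps(2))

definition eq_off :: "nat set \<Rightarrow> (nat \<Rightarrow> nat) \<Rightarrow> (nat \<Rightarrow> nat) \<Rightarrow> bool" where
  "eq_off X f g \<longleftrightarrow> (\<forall>i. i \<notin> X \<longrightarrow> g i = f i)"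

text \<open>
  Register 5 holds the current node and register 6 a new key; registers 7 to 13 are scratch.
\<close>

definition base_regs :: "nat \<Rightarrow> nat \<Rightarrow> nat \<Rightarrow> nat \<Rightarrow> (nat \<Rightarrow> nat) \<Rightarrow> bool" where
  "base_regs W P A D R \<longleftrightarrow> R 1 = 1 \<and> R 2 = P \<and> R 3 = A \<and> R 4 = D mod 2 ^ W"

text \<open>A cell holds the residue of the true minimum, not the minimum of residues; the unbounded
  keys \<open>f\<close> exist only in the proof.\<close>

definition tree_mem :: "nat \<Rightarrow> nat \<Rightarrow> nat \<Rightarrow> (nat \<Rightarrow> nat) \<Rightarrow> (nat \<Rightarrow> nat) \<Rightarrow> bool" where
  "tree_mem W P A f m \<longleftrightarrow> (\<forall>k. 0 < k \<and> k < 2 * P \<longrightarrow> m (A + k) = tree_min P f k mod 2 ^ W)"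

definition window :: "nat \<Rightarrow> nat \<Rightarrow> nat \<Rightarrow> (nat \<Rightarrow> nat) \<Rightarrow> bool" where
  "window W P D f \<longleftrightarrow> (\<forall>l\<in>{P..<2 * P}. D \<le> f l \<and> f l < D + 2 ^ W)"

text \<open>Register 4, the day, is subtracted from both children before they are compared, because
  the order of the residues themselves says nothing once a key has wrapped around.\<close>

definition pull :: com where
  "pull = Seq
     (Block [Arith Add 8 3 5, Arith Add 9 8 5, Load 10 9, Arith Add 9 9 1, Load 11 9,
        Arith Sub 12 10 4, Arith Sub 13 11 4])
     (IfLess 13 12 (Block [Store 8 11]) (Block [Store 8 10]))"

lemma wp_pull:
  assumes R: "base_regs W P A D R" "R 5 = r" "0 < r" "r < P"
    and M: "A + 2 * P \<le> M" "M \<le> 2 ^ W"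
    and win: "window W P D f"
    and m: "m (A + 2 * r) = tree_min P f (2 * r) mod 2 ^ W"
      "m (A + 2 * r + 1) = tree_min P f (2 * r + 1) mod 2 ^ W"
    and Q: "\<And>R'. eq_off {8..13} R R' \<Longrightarrow> Q R' (m(A + r := tree_min P f r mod 2 ^ W))"
  shows "wp W M pull 10 Q R m"
proof -
  let ?a = "tree_min P f (2 * r)" and ?b = "tree_min P f (2 * r + 1)"
  have wa: "D \<le> ?a" "?a < D + 2 ^ W"
    and wb: "D \<le> ?b" "?b < D + 2 ^ W"
    using tree_min_window[of P D f "2 ^ W" "2 * r"] tree_min_window[of P D f "2 ^ W" "2 * r + 1"] win R
    by (auto simp: window_def)
  note sub = arith_Sub_mod[OF wa] arith_Sub_mod[OF wb]
  have node: "tree_min P f r = min ?a ?b" using R by (simp add: tree_min_node)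
  have "A + r < 2 ^ W" "A + r + r < 2 ^ W" "A + r + r + 1 < 2 ^ W" 
    "A + r < M" "A + r + r < M" "A + r + r + 1 < M" using R M by linarith+
  note b = this
  have m': "m (A + r + r) = ?a mod 2 ^ W" "m (A + r + r + 1) = ?b mod 2 ^ W"
    using m by (simp_all add: mult_2 add.assoc)
  show ?thesis
    unfolding pull_def
    apply (rule wp_block_seq)
     apply (use R b m' in \<open>simp add: base_regs_def sub del: One_nat_def\<close>)
     apply (rule wp_if)
       apply (rule wp_block)
        apply (use b in \<open>simp\<close>)
    subgoal premises prems
    proof -
      have "?b < ?a" using prems(5-) wb wa sub by simp
      then show ?thesis using Q node by (simp add: eq_off_def)
    qed
       apply simp
      apply (rule wp_block)
       apply (use b in \<open>simp\<close>)
    subgoal premises prems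
    proof -
      have "?a \<le> ?b" using prems wb wa sub by simp
      then show ?thesis using Q node by (simp add: eq_off_def min_def)
    qed
      apply simp
     apply simp
    apply simp
    done
qed

section \<open>Tree operations: path update, linear-time construction, leftmost search\<close>

definition scratch :: "nat set" where
  "scratch = insert 5 {7..13}"

lemma eq_off_refl [simp]: "eq_off X f f"
  by (simp add: eq_off_def)

lemma eq_off_trans: "eq_off X f g \<Longrightarrow> eq_off X g h \<Longrightarrow> eq_off X f h"
  by (simp add: eq_off_def)

lemma eq_off_mono: "eq_off X f g \<Longrightarrow> X \<subseteq> Y \<Longrightarrow> eq_off Y f g"
  by (auto simp: eq_off_def)

lemma eq_off_fun_upd: "eq_off X f g \<Longrightarrow> i \<in> X \<Longrightarrow> eq_off X f (g(i := v))"
  by (auto simp: eq_off_def)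

lemma eq_off_base_regs:
  "eq_off X R R' \<Longrightarrow> X \<inter> {1, 2, 3, 4} = {} \<Longrightarrow> base_regs W P A D R \<Longrightarrow> base_regs W P A D R'"
  by (auto simp: eq_off_def base_regs_def)

definition update :: com where
  "update = Seq (Block [Arith Add 7 3 5, Store 7 6])
     (WhileLess 1 5 (Seq (Block [Const 7 2, Arith Div 5 5 7]) pull))"

lemma wp_update:
  assumes R: "base_regs W P A D R" "R 5 = l" "R 6 = v mod 2 ^ W" and l: "P \<le> l" "l < 2 * P"
    and P: "P = 2 ^ k" and M: "A + 2 * P \<le> M" "M \<le> 2 ^ W" "2 < M"
    and win: "window W P D (f(l := v))" and m: "tree_mem W P A f m"
    and Q: "\<And>R' m'. \<lbrakk>eq_off scratch R R'; eq_off {A..<A + 2 * P} m m';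
       tree_mem W P A (f(l := v)) m'\<rbrakk> \<Longrightarrow> Q R' m'"
    and t: "4 + 14 * k \<le> t"
  shows "wp W M update t Q R m"
proof -
  let ?f = "f(l := v)"
  \<comment> \<open>Only strict ancestors of the current node may still show an old minimum. The
    current node is \<open>k - j\<close> levels above the leaf, so with \<open>j = 0\<close> it is
    the root and no node is exempt.\<close>
  define I where "I j R' m' \<longleftrightarrow> j \<le> k \<and> R' 5 = l div 2 ^ (k - j) \<and> eq_off scratch R R' \<and>
    eq_off {A..<A + 2 * P} m m' \<and>
    (\<forall>i. 0 < i \<and> i < 2 * P \<and> (\<forall>e>k - j. i \<noteq> l div 2 ^ e) \<longrightarrow>
       m' (A + i) = tree_min P ?f i mod 2 ^ W)" for j R' m'
  have 1: "R' 1 < R' 5 \<and> wp W M (Seq (Block [Const 7 2, Arith Div 5 5 7]) pull) 12 (I j) R' m'"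
    if I: "I (Suc j) R' m'" for j R' m'
  proof
    let ?e = "k - Suc j"
    let ?r = "l div 2 ^ (k - j)"
    have kj: "k - j = Suc ?e" using I by (auto simp: I_def)
    have r: "R' 5 = l div 2 ^ ?e" using I by (simp add: I_def)
    have bR: "base_regs W P A D R'"
      using I R(1) eq_off_base_regs[of scratch] by (auto simp: I_def scratch_def)
    have "2 * 2 ^ ?e \<le> (2::nat) ^ k"
      using kj by (metis diff_le_self power_Suc power_increasing one_le_numeral)
    then have "2 * 2 ^ ?e \<le> l" using l P by simp
    then have "2 \<le> l div 2 ^ ?e" 
      by (simp add: less_eq_div_iff_mult_less_eq)
    then show "R' 1 < R' 5" using r bR by (simp add: base_regs_def)
    have rr: "?r = l div 2 ^ ?e div 2" unfolding kj power_Suc2 div_mult2_eq ..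
    have "l div 2 ^ ?e \<le> l" by simp
    then have rP: "0 < ?r" "?r < P" using \<open>2 \<le> l div 2 ^ ?e\<close> l unfolding rr by linarith+
    have le: "l div 2 ^ e \<le> ?r" if "e > ?e" for e
    proof -
      have "(2::nat) ^ (k - j) \<le> 2 ^ e" using that kj by (intro power_increasing) auto
      then show ?thesis by (simp add: div_le_mono2)
    qed
    have ch: "m' (A + i) = tree_min P ?f i mod 2 ^ W" if "?r < i" "i < 2 * P" for i
    proof -
      have "\<forall>e>?e. i \<noteq> l div 2 ^ e" using le that by fastforce
      then show ?thesis using I that unfolding I_def by auto
    qed
    show "wp W M (Seq (Block [Const 7 2, Arith Div 5 5 7]) pull) 12 (I j) R' m'"
    proof (rule wp_block_seq)
      have *: "wp W M pull 10 (I j) (R'(7 := 2, 5 := ?r)) m'"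
      proof (rule wp_pull)
        show "base_regs W P A D (R'(7 := 2, 5 := ?r))" using bR by (simp add: base_regs_def)
        show "m' (A + 2 * ?r) = tree_min P ?f (2 * ?r) mod 2 ^ W"
          using ch[of "2 * ?r"] rP by simp
        show "m' (A + 2 * ?r + 1) = tree_min P ?f (2 * ?r + 1) mod 2 ^ W"
          using ch[of "2 * ?r + 1"] rP by simp
        fix R'' assume R'': "eq_off {8..13} (R'(7 := 2, 5 := ?r)) R''"
        have "eq_off scratch R' R''" using R'' by (auto simp: eq_off_def scratch_def)
        moreover have "R'' 5 = ?r" using R'' by (simp add: eq_off_def)
        moreover have "m' (A + i) = tree_min P ?f i mod 2 ^ W"
          if "0 < i" "i < 2 * P" "\<forall>e>k - j. i \<noteq> l div 2 ^ e" "i \<noteq> ?r" for i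
        proof -
          have "\<forall>e>?e. i \<noteq> l div 2 ^ e" using that kj by (metis Suc_lessI)
          then show ?thesis using I that unfolding I_def by auto
        qed
        ultimately show "I j R'' (m'(A + ?r := tree_min P ?f ?r mod 2 ^ W))"
          using I rP unfolding I_def by (auto intro: eq_off_trans eq_off_fun_upd)
      qed (use rP M win in auto)
      have w: "2 mod 2 ^ W = (2::nat)" using M by simp
      show "block_wp W M [Const 7 2, Arith Div 5 5 7]
        (wp W M pull (12 - length [Const 7 2, Arith Div 5 5 7]) (I j)) R' m'"
        using * by (simp add: w r rr)
    qed simp
  qed
  have 2: "\<not> R' 1 < R' 5 \<and> Q R' m'" if I: "I 0 R' m'" for R' m'
  proof
    have "R' 5 = l div 2 ^ k" using I by (simp add: I_def)
    moreover have "l div 2 ^ k < 2" using l P by (simp add: div_less_iff_less_mult mult.commute)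
    moreover have "R' 1 = 1" using I R by (auto simp: I_def base_regs_def eq_off_def scratch_def)
    ultimately show "\<not> R' 1 < R' 5" by simp
    have "l div 2 ^ e = 0" if "k < e" for e
    proof -
      have "(2::nat) ^ Suc k \<le> 2 ^ e" using that by (intro power_increasing) auto
      then show ?thesis using l P by simp
    qed
    then have "\<forall>i>0. \<forall>e>k. i \<noteq> l div 2 ^ e" by fastforce
    then show "Q R' m'" using I Q unfolding I_def tree_mem_def by auto
  qed
  have I: "I k (R(7 := A + l)) (m(A + l := v mod 2 ^ W))"
    unfolding I_def
  proof (intro conjI allI impI)
    show "eq_off scratch R (R(7 := A + l))" by (simp add: eq_off_def scratch_def)
    show "eq_off {A..<A + 2 * P} m (m(A + l := v mod 2 ^ W))" using l by (auto simp: eq_off_def)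
    show "(R(7 := A + l)) 5 = l div 2 ^ (k - k)" using R by simp
    fix i assume i: "0 < i \<and> i < 2 * P \<and> (\<forall>e>k - k. i \<noteq> l div 2 ^ e)"
    show "(m(A + l := v mod 2 ^ W)) (A + i) = tree_min P ?f i mod 2 ^ W"
    proof (cases "i = l")
      case True
      then show ?thesis using l by (simp add: tree_min_leaf)
    next
      case False
      then have "i \<noteq> l div 2 ^ e" for e using i by (cases e) auto
      then have "tree_min P ?f i = tree_min P f i" using i by (intro tree_min_upd) auto
      then show ?thesis using i False m by (simp add: tree_mem_def)
    qed
  qed simp
  have Al: "A + l < M" "A + l < 2 ^ W" using l M by linarith+
  have "wp W M (WhileLess 1 5 (Seq (Block [Const 7 2, Arith Div 5 5 7]) pull)) (k * (12 + 2) + 2) Q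
      (R(7 := A + l)) (m(A + l := v mod 2 ^ W))"
    by (rule wp_while[where I = I, OF 1 2 I])
  then have *: "wp W M (WhileLess 1 5 (Seq (Block [Const 7 2, Arith Div 5 5 7]) pull)) (t - Suc (Suc 0)) Q
      (R(7 := A + l)) (m(A + l := v mod 2 ^ W))"
    by (rule wp_time) (use t in simp)
  show ?thesis
    unfolding update_def
    by (rule wp_block_seq) (use * R Al t in \<open>simp_all add: base_regs_def\<close>)
qed

text \<open>Nodes are filled from \<open>P - 1\<close> down to \<open>1\<close>, so both children
  are final when a node is computed. This takes constant time per node, whereas inserting the leaves
  by \<open>update\<close> would cost a logarithmic factor.\<close>

definition build_tree :: com where
  "build_tree = Seq (Block [Const 5 0, Arith Add 5 5 2])
     (WhileLess 1 5 (Seq (Block [Arith Sub 5 5 1]) pull))"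

lemma arith_Sub: "b \<le> a \<Longrightarrow> a < 2 ^ W \<Longrightarrow> arith_op W Sub a b = a - b"
  using arith_Sub_mod[of b a W] by simp

lemma wp_build_tree:
  assumes R: "base_regs W P A D R" and P: "0 < P" and M: "A + 2 * P \<le> M" "M \<le> 2 ^ W"
    and win: "window W P D f" and m: "\<forall>l\<in>{P..<2 * P}. m (A + l) = f l mod 2 ^ W"
    and Q: "\<And>R' m'. \<lbrakk>eq_off scratch R R'; eq_off {A..<A + P} m m'; tree_mem W P A f m'\<rbrakk> \<Longrightarrow> Q R' m'"
    and t: "4 + 13 * P \<le> t"
  shows "wp W M build_tree t Q R m"
proof -
  define I where "I j R' m' \<longleftrightarrow> Suc j \<le> P \<and> R' 5 = Suc j \<and> eq_off scratch R R' \<and>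
    eq_off {A..<A + P} m m' \<and>
    (\<forall>i. Suc j \<le> i \<and> i < 2 * P \<longrightarrow> m' (A + i) = tree_min P f i mod 2 ^ W)" for j R' m'
  have 1: "R' 1 < R' 5 \<and> wp W M (Seq (Block [Arith Sub 5 5 1]) pull) 11 (I j) R' m'"
    if I: "I (Suc j) R' m'" for j R' m'
  proof
    have bR: "base_regs W P A D R'"
      using I R(1) eq_off_base_regs[of scratch] by (auto simp: I_def scratch_def)
    show "R' 1 < R' 5" using I bR by (simp add: I_def base_regs_def)
    have "Suc (Suc j) < 2 ^ W" using I M P unfolding I_def by linarith
    then have s: "arith_op W Sub (R' 5) (R' 1) = Suc j"
      using I bR by (simp add: arith_Sub I_def base_regs_def)
    show "wp W M (Seq (Block [Arith Sub 5 5 1]) pull) 11 (I j) R' m'"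
    proof (rule wp_block_seq)
      have *: "wp W M pull 10 (I j) (R'(5 := Suc j)) m'"
      proof (rule wp_pull)
        show "base_regs W P A D (R'(5 := Suc j))" using bR by (simp add: base_regs_def)
        show "m' (A + 2 * Suc j) = tree_min P f (2 * Suc j) mod 2 ^ W"
          "m' (A + 2 * Suc j + 1) = tree_min P f (2 * Suc j + 1) mod 2 ^ W"
          using I[unfolded I_def, THEN conjunct2, THEN conjunct2, THEN conjunct2, THEN conjunct2,
              THEN spec, of "2 * Suc j"] 
            I[unfolded I_def, THEN conjunct2, THEN conjunct2, THEN conjunct2, THEN conjunct2,
              THEN spec, of "2 * Suc j + 1"] I unfolding I_def by auto
        fix R'' assume R'': "eq_off {8..13} (R'(5 := Suc j)) R''"
        have "eq_off scratch R' R''" using R'' by (auto simp: eq_off_def scratch_def)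
        moreover have "R'' 5 = Suc j" using R'' by (simp add: eq_off_def)
        moreover have "eq_off {A..<A + P} m (m'(A + Suc j := tree_min P f (Suc j) mod 2 ^ W))"
          using I by (intro eq_off_fun_upd) (auto simp: I_def)
        ultimately show "I j R'' (m'(A + Suc j := tree_min P f (Suc j) mod 2 ^ W))"
          using I unfolding I_def by (auto intro: eq_off_trans)
      qed (use I M win in \<open>auto simp: I_def\<close>)
      show "block_wp W M [Arith Sub 5 5 1]
        (wp W M pull (11 - length [Arith Sub 5 5 1]) (I j)) R' m'"
        using * by (simp add: s del: One_nat_def)
    qed simp
  qed
  have 2: "\<not> R' 1 < R' 5 \<and> Q R' m'" if I: "I 0 R' m'" for R' m'
  proof
    have "R' 1 = 1" using I R by (auto simp: I_def base_regs_def eq_off_def scratch_def)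
    then show "\<not> R' 1 < R' 5" using I by (simp add: I_def)
    have "eq_off {A..<A + P} m m'" "eq_off scratch R R'" using I unfolding I_def by auto
    moreover have "tree_mem W P A f m'" using I unfolding I_def tree_mem_def by auto
    ultimately show "Q R' m'" by (intro Q)
  qed
  have I: "I (P - 1) (R(5 := P)) m"
    unfolding I_def using P m
    by (auto simp: eq_off_def scratch_def tree_min_leaf)
  have s: "P < 2 ^ W" using M P by linarith
  have "wp W M (WhileLess 1 5 (Seq (Block [Arith Sub 5 5 1]) pull)) ((P - 1) * (11 + 2) + 2) Q
      (R(5 := P)) m"
    by (rule wp_while[where I = I, OF 1 2 I])
  then have *: "wp W M (WhileLess 1 5 (Seq (Block [Arith Sub 5 5 1]) pull)) (t - Suc (Suc 0)) Q (R(5 := P)) m"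
    by (rule wp_time) (use t in \<open>simp add: algebra_simps\<close>)
  show ?thesis
    unfolding build_tree_def
    by (rule wp_block_seq) (use * R s t in \<open>simp_all add: base_regs_def\<close>)
qed

text \<open>Only left children are inspected: the minimum at the current node is at most
  \<open>D + P\<close>, so if the left child exceeds this threshold the right child does
  not.\<close>

definition descend :: com where
  "descend = Seq (Block [Const 5 1])
     (WhileLess 5 2 (Seq (Block [Arith Add 5 5 5, Arith Add 7 3 5, Load 8 7, Arith Sub 8 8 4])
       (IfLess 2 8 (Block [Arith Add 5 5 1]) (Block []))))"

lemma wp_descend:
  assumes R: "base_regs W P A D R" and P: "P = 2 ^ k" and M: "A + 2 * P \<le> M" "M \<le> 2 ^ W"
    and win: "window W P D f" and m: "tree_mem W P A f m"
    and ready: "\<exists>l\<in>{P..<2 * P}. f l \<le> D + P"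
    and Q: "\<And>R' l. \<lbrakk>eq_off scratch R R'; R' 5 = l; P \<le> l; l < 2 * P; f l \<le> D + P;
       \<forall>i\<in>{P..<l}. D + P < f i\<rbrakk> \<Longrightarrow> Q R' m"
    and t: "3 + 9 * k \<le> t"
  shows "wp W M descend t Q R m"
proof -
  let ?body = "Seq (Block [Arith Add 5 5 5, Arith Add 7 3 5, Load 8 7, Arith Sub 8 8 4])
       (IfLess 2 8 (Block [Arith Add 5 5 1]) (Block []))"
  \<comment> \<open>Here \<open>l div 2 ^ j\<close> is the ancestor of the leaf \<open>l\<close> on
    the level of the current node. The last clause thus excludes all leaves to the left of the
    current subtree, which makes the leaf found the leftmost ready one.\<close>
  define I where "I j R' m' \<longleftrightarrow> j \<le> k \<and> m' = m \<and> eq_off scratch R R' \<and>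
    2 ^ (k - j) \<le> R' 5 \<and> R' 5 < 2 * 2 ^ (k - j) \<and> tree_min P f (R' 5) \<le> D + P \<and>
    (\<forall>l\<in>{P..<2 * P}. l div 2 ^ j < R' 5 \<longrightarrow> D + P < f l)" for j R' m'
  have 1: "R' 5 < R' 2 \<and> wp W M ?body 7 (I j) R' m'"
    if I: "I (Suc j) R' m'" for j R' m'
  proof
    let ?r = "R' 5"
    have bR: "base_regs W P A D R'"
      using I R(1) eq_off_base_regs[of scratch] by (auto simp: I_def scratch_def)
    have kj: "k - j = Suc (k - Suc j)" using I by (auto simp: I_def)
    have "(2::nat) * 2 ^ (k - Suc j) \<le> P" unfolding P
      using kj by (metis diff_le_self power_Suc power_increasing one_le_numeral)
    then have rP: "0 < ?r" "?r < P" using I unfolding I_def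
      by (auto intro: order.strict_trans2)
    then show "R' 5 < R' 2" using bR by (simp add: base_regs_def)
    have ub: "2 * ?r + 1 < 2 * 2 ^ (k - j)" "2 ^ (k - j) \<le> 2 * ?r" 
      using I unfolding I_def kj power_Suc by auto
    have bd: "?r + ?r < 2 ^ W" "A + (?r + ?r) < 2 ^ W" "A + (?r + ?r) < M" "Suc (?r + ?r) < 2 ^ W" 
      using rP M by linarith+
    have mm: "m' = m" using I by (simp add: I_def)
    have mr: "m (A + (?r + ?r)) = tree_min P f (2 * ?r) mod 2 ^ W"
      using m rP by (simp add: tree_mem_def mult_2)
    have w: "D \<le> tree_min P f (2 * ?r)" "tree_min P f (2 * ?r) < D + 2 ^ W"
      using tree_min_window[of P D f "2 ^ W" "2 * ?r"] rP win by (auto simp: window_def)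
    have node: "min (tree_min P f (2 * ?r)) (tree_min P f (2 * ?r + 1)) \<le> D + P"
      using I rP tree_min_node[of "?r" P f] by (simp add: I_def)
    have old: "D + P < f l" if "l \<in> {P..<2 * P}" "l div 2 ^ j < 2 * ?r" for l
    proof -
      have "l div 2 ^ Suc j < ?r" using that(2) unfolding power_Suc2 div_mult2_eq by linarith
      then show ?thesis using that(1) I unfolding I_def by auto
    qed
    have new: "D + P < f l" if "l \<in> {P..<2 * P}" "l div 2 ^ j < 2 * ?r + 1" 
      "D + P < tree_min P f (2 * ?r)" for l
    proof (cases "l div 2 ^ j < 2 * ?r")
      case False
      then have "l div 2 ^ j = 2 * ?r" using that(2) by simp
      then show ?thesis using tree_min_le[of l P j f] that rP by simp
    qed (use old that in simp)
    show "wp W M ?body 7 (I j) R' m'"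
      apply (rule wp_block_seq)
       apply (use bR bd mr mm in \<open>simp add: base_regs_def arith_Sub_mod[OF w]\<close>)
       apply (rule wp_if)
         apply (rule wp_block)
          apply (use bd bR in \<open>simp add: base_regs_def\<close>)
      subgoal premises prems
      proof -
        have "D + P < tree_min P f (2 * ?r)" using prems w by simp
        then show ?thesis unfolding I_def
          using I ub new node by (auto simp: I_def eq_off_def scratch_def mult_2)
      qed
         apply simp
        apply (rule wp_block)
         apply simp
      subgoal premises prems
      proof -
        have "tree_min P f (2 * ?r) \<le> D + P" using prems w bR by (simp add: base_regs_def)
        then show ?thesis unfolding I_def
          using I ub old by (auto simp: I_def eq_off_def scratch_def mult_2)
      qed
        apply simp
       apply simp
      apply simp
      done
  qed
  have 2: "\<not> R' 5 < R' 2 \<and> Q R' m'" if I: "I 0 R' m'" for R' m'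
  proof -
    have "R' 2 = P" using I R by (auto simp: I_def base_regs_def eq_off_def scratch_def)
    moreover have "P \<le> R' 5" "R' 5 < 2 * P" using I P by (auto simp: I_def)
    moreover have "f (R' 5) \<le> D + P" using I \<open>P \<le> R' 5\<close> by (simp add: I_def tree_min_leaf)
    moreover have "\<forall>i\<in>{P..<R' 5}. D + P < f i" using I \<open>R' 5 < 2 * P\<close> by (auto simp: I_def)
    ultimately show ?thesis using I Q[of R' "R' 5"] unfolding I_def by auto
  qed
  have "0 < P" using P by simp
  obtain l where l: "l \<in> {P..<2 * P}" "f l \<le> D + P" using ready by blast
  have "0 < l div 2 ^ k" "l div 2 ^ k < 2" "l < 2 * P"
    using l P by (auto simp: div_less_iff_less_mult mult.commute div_greater_zero_iff)
  then have "l div 2 ^ k = 1" by simp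
  then have root: "tree_min P f 1 \<le> D + P" using tree_min_le[of l P k f] l by simp
  have z: "\<forall>l\<in>{P..<2 * P}. l div 2 ^ k < (R(5 := 1)) 5 \<longrightarrow> D + P < f l"
    using P by (simp add: div_eq_0_iff)
  have I: "I k (R(5 := 1)) m"
    unfolding I_def using root z by (simp add: eq_off_def scratch_def)
  have "wp W M (WhileLess 5 2 ?body) (k * (7 + 2) + 2) Q (R(5 := 1)) m"
    by (rule wp_while[where I = I, OF 1 2 I])
  then have *: "wp W M (WhileLess 5 2 ?body) (t - 1) Q (R(5 := 1)) m"
    by (rule wp_time) (use t in \<open>simp add: algebra_simps\<close>)
  have "(1::nat) < 2 ^ W" using M \<open>0 < P\<close> by linarith
  then have "1 mod 2 ^ W = (1::nat)" by (rule mod_less)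
  then show ?thesis
    unfolding descend_def
    by (intro wp_block_seq) (use * t in simp_all)
qed

section \<open>The query\<close>

text \<open>The sweep follows the update of the trimmed leaf. If both concern the same leaf, the
  sweep reads the new key, which already exceeds \<open>D + P\<close>, and leaves it
  unchanged.\<close>

definition query_com :: com where
  "query_com =
     Seq descend
    (Seq (Block [Arith Add 7 3 2, Arith Add 7 7 5, Load 0 7, Arith Add 7 7 2, Load 6 7,
       Arith Add 6 6 4, Arith Add 6 6 1, Arith Add 6 6 2])
    (Seq update
    (Seq (Block [Arith Mod 5 4 2, Arith Add 5 5 2, Arith Add 7 3 5, Load 6 7, Arith Sub 8 6 4])
    (Seq (IfLess 2 8 (Block []) (Block [Arith Add 6 4 2]))
    (Seq update
      (Block [Arith Add 4 4 1]))))))"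

text \<open>Leaf \<open>l\<close> is trimmed on day \<open>D\<close>, and leaf \<open>P + D mod P\<close> is swept.\<close>

definition next_keys ::
  "nat \<Rightarrow> (nat \<Rightarrow> nat) \<Rightarrow> nat \<Rightarrow> nat \<Rightarrow> (nat \<Rightarrow> nat) \<Rightarrow> nat \<Rightarrow> nat" where
  "next_keys P \<tau> D l f =
     (let g = f(l := Suc D + \<tau> l + P); p = P + D mod P in g(p := max (g p) (D + P)))"

text \<open>
  The key of a leaf is the day on which it becomes ready, shifted by \<open>P\<close>. The witness \<open>D'\<close> below is a
  day on which the periodic sweep visits the leaf and raises a stale key, so that all keys stay
  in a window of length less than \<open>2 ^ W\<close> and can be stored modulo \<open>2 ^ W\<close>.
\<close>

definition keys_ok :: "nat \<Rightarrow> (nat \<Rightarrow> nat) \<Rightarrow> nat \<Rightarrow> (nat \<Rightarrow> nat) \<Rightarrow> bool" where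
  "keys_ok P \<tau> D f \<longleftrightarrow> (\<forall>l\<in>{P..<2 * P}.
     (\<exists>D'\<ge>D. D' mod P = l - P \<and> D' \<le> f l) \<and> f l \<le> D + P + \<tau> l)"

text \<open>\<open>\<gamma> l\<close> is the answer reported for leaf \<open>l\<close> and
  \<open>\<tau> l\<close> the number of days from a reset until it is ready; both stay fixed after
  building. As \<open>l\<close> starts at \<open>P\<close>, the two arrays fill the cells from
  \<open>A + 2 * P\<close> to \<open>A + 4 * P - 1\<close>, right behind the tree.\<close>

definition tables :: "nat \<Rightarrow> nat \<Rightarrow> (nat \<Rightarrow> nat) \<Rightarrow> (nat \<Rightarrow> nat) \<Rightarrow> (nat \<Rightarrow> nat) \<Rightarrow> bool" where
  "tables P A \<gamma> \<tau> m \<longleftrightarrow>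
     (\<forall>l\<in>{P..<2 * P}. m (A + P + l) = \<gamma> l \<and> m (A + 2 * P + l) = \<tau> l)"

text \<open>A witness \<open>D'\<close> expires only when \<open>D' = D\<close>, which is the very
  day on which the sweep visits the leaf; the key is then at least \<open>D + P\<close>, the next
  visiting day, and this is the new witness. Trimming never lowers a key, as the trimmed leaf had a
  key of at most \<open>D + P\<close>.\<close>

lemma keys_ok_next:
  assumes ok: "keys_ok P \<tau> D f" and l: "P \<le> l" "l < 2 * P" "f l \<le> D + P"
  shows "keys_ok P \<tau> (Suc D) (next_keys P \<tau> D l f)"
  unfolding keys_ok_def
proof (intro ballI conjI)
  fix i assume i: "i \<in> {P..<2 * P}"
  let ?g = "next_keys P \<tau> D l f"
  have ge: "f i \<le> ?g i" using l by (auto simp: next_keys_def Let_def)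
  obtain D' where D': "D \<le> D'" "D' mod P = i - P" "D' \<le> f i"
    using ok i unfolding keys_ok_def by blast
  show "\<exists>D'\<ge>Suc D. D' mod P = i - P \<and> D' \<le> ?g i"
  proof (cases "D' = D")
    case False
    then show ?thesis using D' ge by (intro exI[of _ D']) auto
  next
    case True
    then have p: "P + D mod P = i" using D' i by simp
    then show ?thesis using True D' i
      by (intro exI[of _ "D + P"]) (auto simp: next_keys_def Let_def)
  qed
  have "f i \<le> D + P + \<tau> i" using ok i unfolding keys_ok_def by blast
  then show "?g i \<le> Suc D + P + \<tau> i" using i
    by (auto simp: next_keys_def Let_def)
qed

text \<open>The time consists of one descent, \<open>3 + 9 * k\<close>, two path updates,
  \<open>4 + 14 * k\<close> each, and 17 steps between and after them.\<close>

lemma wp_query: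
  assumes R: "base_regs W P A D R" and P: "P = 2 ^ k"
    and M: "A + 4 * P \<le> M" "M \<le> 2 ^ W"
    and m: "tree_mem W P A f m" "tables P A \<gamma> \<tau> m"
    and ok: "keys_ok P \<tau> D f" and small: "\<forall>l\<in>{P..<2 * P}. Suc (P + \<tau> l) < 2 ^ W"
    and ready: "\<exists>l\<in>{P..<2 * P}. f l \<le> D + P"
    and Q: "\<And>R' m' l. \<lbrakk>P \<le> l; l < 2 * P; f l \<le> D + P; \<forall>i\<in>{P..<l}. D + P < f i; R' 0 = \<gamma> l;
       base_regs W P A (Suc D) R'; tree_mem W P A (next_keys P \<tau> D l f) m';
       tables P A \<gamma> \<tau> m'; keys_ok P \<tau> (Suc D) (next_keys P \<tau> D l f)\<rbrakk> \<Longrightarrow> Q R' m'"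
    and t: "28 + 37 * k \<le> t"
  shows "wp W M query_com t Q R m"
proof -
  have P0: "0 < P" using P by simp
  \<comment> \<open>The extra \<open>Suc\<close> covers the stage between trimming and the end of
    the query: the trimmed leaf already has its key for day \<open>Suc D\<close>, while register 4
    still holds \<open>D\<close>.\<close>
  have win: "window W P D g"
    if "\<forall>l\<in>{P..<2 * P}. D \<le> g l \<and> g l \<le> Suc (D + P + \<tau> l)" for g
    unfolding window_def
  proof
    fix l assume "l \<in> {P..<2 * P}"
    then have "D \<le> g l" "g l \<le> Suc (D + P + \<tau> l)" "Suc (P + \<tau> l) < 2 ^ W"
      using that small by auto
    then show "D \<le> g l \<and> g l < D + 2 ^ W" by linarith
  qed
  have fb: "D \<le> f l \<and> f l \<le> D + P + \<tau> l" if "l \<in> {P..<2 * P}" for l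
    using ok that order_trans unfolding keys_ok_def by blast
  have tab: "tables P A \<gamma> \<tau> m''" if "tables P A \<gamma> \<tau> m'" "eq_off {A..<A + 2 * P} m' m''" for m' m''
    using that by (auto simp: tables_def eq_off_def)
  have M2: "A + 2 * P \<le> M" "2 < M" using M P0 by linarith+
  show ?thesis
    unfolding query_com_def
  proof (rule wp_seq[where t = "3 + 9 * k"], rule wp_descend[OF R P M2(1) M(2)])
    show "window W P D f" using win fb by (auto simp: le_SucI)
    fix R1 l
    assume R1: "eq_off scratch R R1" "R1 5 = l" and l: "P \<le> l" "l < 2 * P" "f l \<le> D + P"
      "\<forall>i\<in>{P..<l}. D + P < f i"
    let ?v = "Suc D + \<tau> l + P"
    let ?g = "f(l := ?v)"
    let ?p = "P + D mod P"
    have bR1: "base_regs W P A D R1"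
      using R R1 eq_off_base_regs[of scratch] by (auto simp: scratch_def)
    have gb: "D \<le> ?g i \<and> ?g i \<le> Suc (D + P + \<tau> i)" if "i \<in> {P..<2 * P}" for i
      using fb[OF that] by auto
    have p: "P \<le> ?p" "?p < 2 * P" using P0 by (simp_all add: mult_2)
    have ad: "A + P < 2 ^ W" "A + P + l < 2 ^ W" "A + P + l + P < 2 ^ W" "A + ?p < 2 ^ W" "?p < 2 ^ W"
       "A + P + l < M" "A + P + l + P < M" "A + ?p < M"
      using l p M by linarith+
    have e: "A + P + l + P = A + 2 * P + l" by simp
    have tl: "m (A + P + l) = \<gamma> l" "m (A + P + l + P) = \<tau> l"
      unfolding e using m(2) l by (simp_all add: tables_def)
    have v: "(((\<tau> l + D mod 2 ^ W) mod 2 ^ W + 1) mod 2 ^ W + P) mod 2 ^ W = ?v mod 2 ^ W"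
      by (simp add: mod_simps add.commute)
    \<comment> \<open>Both are powers of two, so the swept position \<open>D mod P\<close> can be
      read off the residue of \<open>D\<close>.\<close>
    have "P dvd 2 ^ W"
    proof -
      have "(2::nat) ^ k < 2 ^ W" using P M P0 by linarith
      then show ?thesis unfolding P by (intro le_imp_power_dvd) simp
    qed
    then have mp: "D mod 2 ^ W mod P = D mod P" by (rule mod_mod_cancel)
    show "wp W M
      (Seq (Block [Arith Add 7 3 2, Arith Add 7 7 5, Load 0 7, Arith Add 7 7 2, Load 6 7,
       Arith Add 6 6 4, Arith Add 6 6 1, Arith Add 6 6 2])
      (Seq update
      (Seq (Block [Arith Mod 5 4 2, Arith Add 5 5 2, Arith Add 7 3 5, Load 6 7, Arith Sub 8 6 4])
      (Seq (IfLess 2 8 (Block []) (Block [Arith Add 6 4 2]))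
      (Seq update
        (Block [Arith Add 4 4 1])))))) (t - (3 + 9 * k)) Q R1 m"
    proof (rule wp_block_seq)
      let ?R2 = "R1(7 := A + P + l + P, 0 := \<gamma> l, 6 := ?v mod 2 ^ W)"
      let ?rest = "Seq (Block [Arith Mod 5 4 2, Arith Add 5 5 2, Arith Add 7 3 5, Load 6 7, Arith Sub 8 6 4])
        (Seq (IfLess 2 8 (Block []) (Block [Arith Add 6 4 2]))
        (Seq update
          (Block [Arith Add 4 4 1])))"
      define t2 where "t2 = t - (3 + 9 * k) - 8"
      have *: "wp W M (Seq update ?rest) t2 Q ?R2 m"
      proof (rule wp_seq[where t = "4 + 14 * k"], rule wp_update[OF _ _ _ _ _ P M2(1) M(2) M2(2)])
        show "base_regs W P A D ?R2" using bR1 by (simp add: base_regs_def)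
        show "?R2 5 = l" using R1 by simp
        show "?R2 6 = ?v mod 2 ^ W" by simp
        show "window W P D ?g" using win gb by blast
        show "tree_mem W P A f m" by (rule m(1))
        fix R3 m3
        assume R3: "eq_off scratch ?R2 R3" and m3: "eq_off {A..<A + 2 * P} m m3" "tree_mem W P A ?g m3"
        have bR3: "base_regs W P A D R3" and R30: "R3 0 = \<gamma> l"
          using bR1 R3 by (simp_all add: base_regs_def eq_off_def scratch_def)
        have lp: "m3 (A + ?p) = ?g ?p mod 2 ^ W"
          using m3 p P0 by (simp add: tree_mem_def tree_min_leaf)
        let ?w = "max (?g ?p) (D + P)"
        have gp: "D \<le> ?g ?p" "?g ?p < D + 2 ^ W"
          using gb[of ?p] p win[of ?g] gb by (auto simp: window_def)
        define G where "G = ?g ?p"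
        define t3 where "t3 = t2 - (4 + 14 * k) - 5"
        have upd2: "wp W M (Seq update (Block [Arith Add 4 4 1])) (t3 - 3) Q R4 m3"
          if "base_regs W P A D R4" "R4 0 = \<gamma> l" "R4 5 = ?p" "R4 6 = ?w mod 2 ^ W" for R4
        proof (rule wp_seq[where t = "4 + 14 * k"], 
            rule wp_update[OF that(1,3,4) p P M2(1) M(2) M2(2) _ m3(2)])
          show "window W P D (?g(?p := ?w))"
          proof (intro win ballI)
            fix i assume i: "i \<in> {P..<2 * P}"
            have "D \<le> ?w \<and> ?w \<le> Suc (D + P + \<tau> ?p)"
              using gb[of ?p] p by (auto simp del: fun_upd_apply)
            then show "D \<le> (?g(?p := ?w)) i \<and> (?g(?p := ?w)) i \<le> Suc (D + P + \<tau> i)"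
              using gb[OF i] unfolding fun_upd_apply[of ?g ?p ?w i] by presburger
          qed
          fix R5 m5
          assume R5: "eq_off scratch R4 R5" and m5: "eq_off {A..<A + 2 * P} m3 m5"
            "tree_mem W P A (?g(?p := ?w)) m5"
          have nk: "next_keys P \<tau> D l f = ?g(?p := ?w)" by (simp add: next_keys_def Let_def)
          have R50: "R5 0 = \<gamma> l" "R5 1 = 1" "R5 2 = P" "R5 3 = A" "R5 4 = D mod 2 ^ W"
            using R5 that(1,2) by (simp_all add: eq_off_def base_regs_def scratch_def)
          have "Q (R5(4 := Suc D mod 2 ^ W)) m5"
          proof (rule Q[OF l])
            show "tables P A \<gamma> \<tau> m5" using tab m(2) m3 m5 by blast
          qed (use R50 m5 nk keys_ok_next[OF ok l(1-3)] in \<open>simp_all add: base_regs_def\<close>)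
          then show "wp W M (Block [Arith Add 4 4 1]) (t3 - 3 - (4 + 14 * k)) Q R5 m5"
            using t R50 by (intro wp_block) (simp_all add: mod_Suc_eq t3_def t2_def)
        qed (use t in \<open>simp_all add: t3_def t2_def\<close>)
        let ?R3 = "R3(5 := ?p, 7 := A + ?p, 6 := ?g ?p mod 2 ^ W, 8 := ?g ?p - D)"
        have "wp W M (Seq (IfLess 2 8 (Block []) (Block [Arith Add 6 4 2]))
             (Seq update (Block [Arith Add 4 4 1]))) t3 Q ?R3 m3"
        proof (rule wp_seq[where t = 3], rule wp_if, goal_cases)
          case 1
          then have w: "?w = ?g ?p" using bR3 gp by (auto simp: base_regs_def)
          have "wp W M (Seq update (Block [Arith Add 4 4 1])) (t3 - 3) Q ?R3 m3"
          proof (rule upd2)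
            show "base_regs W P A D ?R3" using bR3 by (simp add: base_regs_def)
            show "?R3 6 = ?w mod 2 ^ W" unfolding w by simp
          qed (use R30 in simp_all)
          then show ?case by (intro wp_block) simp_all
        next
          case 2
          then have w: "?w = D + P" using bR3 gp by (simp add: base_regs_def)
          have "wp W M (Seq update (Block [Arith Add 4 4 1])) (t3 - 3) Q
              (?R3(6 := (D mod 2 ^ W + P) mod 2 ^ W)) m3"
          proof (rule upd2)
            show "base_regs W P A D (?R3(6 := (D mod 2 ^ W + P) mod 2 ^ W))"
              using bR3 by (simp add: base_regs_def)
            show "(?R3(6 := (D mod 2 ^ W + P) mod 2 ^ W)) 6 = ?w mod 2 ^ W"
              unfolding w by (simp add: mod_simps)
          qed (use R30 in simp_all)
          moreover have "?R3 4 = D mod 2 ^ W" "?R3 2 = P" using bR3 by (simp_all add: base_regs_def)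
          ultimately show ?case
            by (intro wp_block) (simp_all only: block_wp.simps arith_op.simps, simp_all)
        qed (use t in \<open>simp_all add: t3_def t2_def\<close>)
        then have rest: "wp W M (Seq (IfLess 2 8 (Block []) (Block [Arith Add 6 4 2]))
             (Seq update (Block [Arith Add 4 4 1]))) t3 Q
             (R3(5 := ?p, 7 := A + ?p, 6 := G mod 2 ^ W, 8 := G - D)) m3"
          unfolding G_def .
        have lpG: "m3 (A + ?p) = G mod 2 ^ W" "arith_op W Sub (G mod 2 ^ W) (D mod 2 ^ W) = G - D"
          unfolding G_def by (fact lp, rule arith_Sub_mod[OF gp])
        have t3: "t2 - (4 + 14 * k) - length [Arith Mod 5 4 2, Arith Add 5 5 2, Arith Add 7 3 5,
            Load 6 7, Arith Sub 8 6 4] = t3"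
          by (simp add: t3_def)
        show "wp W M ?rest (t2 - (4 + 14 * k)) Q R3 m3"
        proof (rule wp_block_seq)
          show "block_wp W M [Arith Mod 5 4 2, Arith Add 5 5 2, Arith Add 7 3 5, Load 6 7, Arith Sub 8 6 4]
             (wp W M (Seq (IfLess 2 8 (Block []) (Block [Arith Add 6 4 2]))
             (Seq update (Block [Arith Add 4 4 1]))) (t2 - (4 + 14 * k) - length [Arith Mod 5 4 2,
             Arith Add 5 5 2, Arith Add 7 3 5, Load 6 7, Arith Sub 8 6 4]) Q) R3 m3"
            unfolding t3 using bR3 ad lpG rest
            by (simp add: base_regs_def mp add.commute[of "D mod P" P])
        qed (use t in \<open>simp_all add: t2_def\<close>)
      qed (use l t in \<open>simp_all add: t2_def\<close>)
      show "block_wp W M [Arith Add 7 3 2, Arith Add 7 7 5, Load 0 7, Arith Add 7 7 2, Load 6 7,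
       Arith Add 6 6 4, Arith Add 6 6 1, Arith Add 6 6 2] (wp W M (Seq update ?rest)
       (t - (3 + 9 * k) - length [Arith Add 7 3 2, Arith Add 7 7 5, Load 0 7, Arith Add 7 7 2, Load 6 7,
       Arith Add 6 6 4, Arith Add 6 6 1, Arith Add 6 6 2]) Q) R1 m"
      proof -
        have r: "R1 1 = 1" "R1 2 = P" "R1 3 = A" "R1 4 = D mod 2 ^ W" "R1 5 = l"
          using bR1 R1 by (simp_all add: base_regs_def)
        have len: "length [Arith Add 7 3 2, Arith Add 7 7 5, Load 0 7, Arith Add 7 7 2, Load 6 7,
           Arith Add 6 6 4, Arith Add 6 6 1, Arith Add 6 6 2] = 8" by simp
        show ?thesis
          unfolding len t2_def[symmetric] block_wp.simps arith_op.simps(1)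
          using ad tl r * by (simp add: v fun_upd_twist del: One_nat_def)
      qed
    qed (use t in simp_all)
  qed (use m ready t in auto)
qed

section \<open>The build program\<close>

text \<open>
  From here on registers 14 to 19 hold \<open>n\<close>, numerator and denominator of \<open>x\<close>, the sum (later its
  square) of the numerators of the rates, the loop counter, and \<open>n + 1\<close>; register 6 holds the
  largest word, which serves as infinity in the tournament.
\<close>

definition init_com :: com where
  "init_com = Block [Const 1 1, Const 7 0, Load 14 7, Load 15 1, Const 7 2, Load 16 7,
     Const 7 0, Arith Sub 6 7 1, Arith Add 3 14 14, Const 7 3, Arith Add 3 3 7,
     Arith Add 19 14 1, Const 2 1, Const 4 0, Const 17 0, Const 18 0]"

text \<open>Testing against \<open>n + 1\<close> instead of \<open>n\<close> makes the result
  strictly larger than \<open>n\<close>, so at least one leaf carries no bamboo.\<close>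

definition power_com :: com where
  "power_com = WhileLess 2 19 (Block [Arith Add 2 2 2])"

definition sum_com :: com where
  "sum_com = WhileLess 18 14 (Block [Arith Add 7 18 18, Const 8 3, Arith Add 7 7 8, Load 8 7,
     Arith Add 17 17 8, Arith Add 18 18 1])"

definition keys_com :: com where
  "keys_com = WhileLess 18 14 (Block [Arith Add 7 18 18, Const 8 3, Arith Add 7 7 8, Load 9 7,
     Arith Add 7 7 1, Load 10 7, Arith Mul 10 10 17, Arith Div 10 10 9, Arith Mul 10 10 14,
     Arith Add 10 10 18, Arith Add 7 3 2, Arith Add 7 7 18, Store 7 10, Arith Add 18 18 1])"

definition pad_com :: com where
  "pad_com = WhileLess 18 2
     (Block [Arith Add 7 3 2, Arith Add 7 7 18, Store 7 6, Arith Add 18 18 1])"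

text \<open>The root gives only the least key. Since the index was appended to it, the bamboo is
  recovered as the remainder modulo \<open>n\<close>; its leaf is then overwritten by
  infinity.\<close>

definition extract_com :: com where
  "extract_com = WhileLess 18 14
     (Seq (Block [Arith Add 7 3 1, Load 7 7, Arith Mod 5 7 14,
        Arith Add 9 3 2, Arith Add 9 9 2, Arith Add 9 9 18, Arith Add 8 5 1, Store 9 8,
        Arith Add 9 9 2, Arith Add 8 5 5, Const 10 3, Arith Add 8 8 10, Load 12 8,
        Arith Add 8 8 1, Load 13 8, Arith Mul 13 15 13, Arith Sub 13 13 1, Arith Mul 12 16 12,
        Arith Div 13 13 12, Store 9 13, Arith Add 5 5 2])
     (Seq update (Block [Arith Add 18 18 1])))"

text \<open>The sorting tree is exhausted at this point, and its leaves are reused for the keys of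
  day 0.\<close>

definition leaves_com :: com where
  "leaves_com = WhileLess 18 2
     (Block [Arith Add 7 3 2, Arith Add 7 7 18, Arith Add 8 7 2, Arith Add 8 8 2, Load 9 8,
        Arith Add 9 9 2, Store 7 9, Arith Add 18 18 1])"

definition build_com :: com where
  "build_com =
     Seq init_com (Seq power_com (Seq sum_com (Seq (Block [Arith Mul 17 17 17, Const 18 0])
    (Seq keys_com (Seq pad_com (Seq build_tree (Seq (Block [Const 18 0])
    (Seq extract_com (Seq (Block [Const 18 0]) (Seq leaves_com build_tree))))))))))"

text \<open>\<open>B\<close> bounds every number of the input. The assumption on \<open>W\<close>
  makes all intermediate results fit into a word; the largest are the tournament keys, which are
  below \<open>B ^ 6 + B\<close>. The bounds on \<open>2 ^ k\<close> say that it is the least power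
  of two above \<open>n\<close>.\<close>

locale garden =
  fixes W B n k xp xq :: nat and p q :: "nat \<Rightarrow> nat"
  assumes n: "0 < n" "n < B"
    and xp: "0 < xp" "xp < B" and xq: "0 < xq" "xq < B"
    and pq: "\<And>i. i < n \<Longrightarrow> 0 < p i \<and> p i < B \<and> 0 < q i \<and> q i < B"
    and k: "n < 2 ^ k" "2 ^ k \<le> 2 * n"
    and W: "16 * B ^ 8 \<le> 2 ^ W"
begin

definition P :: nat where "P = 2 ^ k"
definition A :: nat where "A = 2 * n + 3"
definition M :: nat where "M = A + 4 * P"
definition N :: nat where "N = (\<Sum>i<n. p i)"

text \<open>
  Since \<open>N\<close> bounds all numerators, rounding \<open>q / p\<close> to the grid of mesh \<open>1 / N\<^sup>2\<close> keeps distinct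
  fractions apart; the index is appended to break ties.
\<close>

definition key :: "nat \<Rightarrow> nat" where
  "key i = (q i * (N * N) div p i) * n + i"

text \<open>One less than the rounded up quotient of \<open>x\<close> and the \<open>i\<close>-th rate.\<close>

definition wait :: "nat \<Rightarrow> nat" where
  "wait i = (xp * q i - 1) div (xq * p i)"

section \<open>Size bounds for intermediate numbers\<close>

lemma nP: "n < P" "P \<le> 2 * n" "0 < P"
  using k by (simp_all add: P_def)

lemma B_ge_2: "2 \<le> B"
  using n by simp

lemma pow_le: "j \<le> 8 \<Longrightarrow> 16 * B ^ j \<le> 2 ^ W"
  using W power_increasing[of j 8 B] B_ge_2 by linarith

lemma M_less: "M < 2 ^ W"
  using pow_le[of 1] n nP by (simp add: M_def A_def)

lemma layout: "M = A + 4 * P" "A = 2 * n + 3" by (simp_all add: M_def A_def)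

lemma pow_pos: "0 < B ^ j"
  using B_ge_2 by simp

lemma W_small: "16 \<le> (2::nat) ^ W"
  using pow_le[of 0] by simp

lemma N_le: "s \<le> n \<Longrightarrow> (\<Sum>i<s. p i) \<le> s * B"
  using sum_bounded_above[of "{..<s}" p B] pq by (simp add: less_imp_le)

lemma N_le': "s \<le> n \<Longrightarrow> (\<Sum>i<s. p i) \<le> B ^ 2"
  using N_le[of s] n by (simp add: power2_eq_square) (meson le_trans mult_le_mono1 less_imp_le)

lemma N2: "N * N \<le> B ^ 4"
  using mult_le_mono[OF N_le'[of n] N_le'[of n]] by (simp add: N_def power_add[symmetric])

lemma qN2: "i < n \<Longrightarrow> q i * (N * N) \<le> B ^ 5"
  using mult_le_mono[OF _ N2, of "q i" B] pq[of i] by (simp add: less_imp_le power_numeral_reduce)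

lemma qN2n: "i < n \<Longrightarrow> (q i * (N * N) div p i) * n \<le> B ^ 6"
proof -
  assume "i < n"
  then have "q i * (N * N) div p i \<le> B ^ 5" using qN2 div_le_dividend le_trans by blast
  from mult_le_mono[OF this less_imp_le[OF n(2)]] show ?thesis by (simp add: power_numeral_reduce mult.commute)
qed

lemma key_less: "i < n \<Longrightarrow> key i < 2 ^ W - 1"
  using qN2n[of i] pow_le[of 6] pow_le[of 1] n unfolding key_def by simp

lemma key_mod: "i < n \<Longrightarrow> key i mod n = i"
  by (simp add: key_def)

lemma xq_le: "i < n \<Longrightarrow> xp * q i \<le> B ^ 2"
  using mult_le_mono[of xp B "q i" B] xp pq[of i] by (simp add: power2_eq_square)

lemma xq_le': "i < n \<Longrightarrow> xq * p i \<le> B ^ 2"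
  using mult_le_mono[of xq B "p i" B] xq pq[of i] by (simp add: power2_eq_square)

lemma wait_le: "i < n \<Longrightarrow> wait i \<le> B ^ 2"
  unfolding wait_def using xq_le[of i] by (meson diff_le_self div_le_dividend le_trans)

text \<open>A key leads the current day by at most \<open>P + wait i\<close>, and by one more within
  a query; hence all keys fit into a window shorter than the modulus.\<close>

lemma wait_small: "i < n \<Longrightarrow> Suc (P + wait i) < 2 ^ W"
proof -
  assume "i < n"
  have "P \<le> 2 * B" "2 \<le> B" using nP n B_ge_2 by linarith+
  moreover have "2 * B \<le> B ^ 2" using B_ge_2 by (simp add: power2_eq_square)
  moreover have "wait i \<le> B ^ 2" by (rule wait_le[OF \<open>i < n\<close>])
  moreover have "16 * B ^ 2 \<le> 2 ^ W" by (rule pow_le) simp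
  ultimately show ?thesis by linarith
qed

definition std_regs :: "(nat \<Rightarrow> nat) \<Rightarrow> bool" where
  "std_regs R \<longleftrightarrow> R 1 = 1 \<and> R 2 = P \<and> R 3 = A \<and> R 4 = 0 \<and> R 6 = 2 ^ W - 1 \<and>
     R 14 = n \<and> R 15 = xp \<and> R 16 = xq"

definition input_mem :: "(nat \<Rightarrow> nat) \<Rightarrow> bool" where
  "input_mem m \<longleftrightarrow> (\<forall>i<n. m (i + i + 3) = p i \<and> m (i + i + 3 + 1) = q i)"

lemma std_base: "std_regs R \<Longrightarrow> base_regs W P A 0 R"
  by (simp add: std_regs_def base_regs_def)

lemma std_off: "std_regs R \<Longrightarrow> eq_off X R R' \<Longrightarrow> X \<inter> {1,2,3,4,6,14,15,16} = {} \<Longrightarrow> std_regs R'"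
  by (auto simp: std_regs_def eq_off_def)

lemma input_off: "input_mem m \<Longrightarrow> eq_off X m m' \<Longrightarrow> X \<inter> {..<A} = {} \<Longrightarrow> input_mem m'"
proof -
  assume a: "input_mem m" "eq_off X m m'" "X \<inter> {..<A} = {}"
  have "i + i + 3 \<notin> X \<and> i + i + 3 + 1 \<notin> X" if "i < n" for i
    using a(3) that by (auto simp: A_def)
  then show ?thesis using a(1,2) by (auto simp: input_mem_def eq_off_def)
qed

lemma bounds:
  assumes "i < n"
  shows "i + i + 3 + 1 < M" "i + i + 3 + 1 < 2 ^ W" "i + 1 < 2 ^ W"
  using assms M_less by (simp_all add: M_def A_def)

section \<open>Loop invariants of the build stages\<close>

lemma wp_init:
  assumes m: "m 0 = n" "m 1 = xp" "m 2 = xq"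
    and Q: "\<And>R'. \<lbrakk>R' 1 = 1 \<and> R' 2 = 1 \<and> R' 3 = A \<and> R' 4 = 0 \<and> R' 6 = 2 ^ W - 1 \<and> R' 14 = n \<and>
       R' 15 = xp \<and> R' 16 = xq \<and> R' 17 = 0 \<and> R' 18 = 0 \<and> R' 19 = n + 1\<rbrakk> \<Longrightarrow> Q R' m"
    and t: "16 \<le> t"
  shows "wp W M init_com t Q R m"
proof -
  have w: "1 mod 2 ^ W = (1::nat)" "2 mod 2 ^ W = (2::nat)" "3 mod 2 ^ W = (3::nat)"
    by (rule mod_less, use W_small in linarith)+
  have b: "n + n < 2 ^ W" "2 * n + 3 < 2 ^ W" "n + 1 < 2 ^ W" "0 < M" "1 < M" "2 < M"
    using M_less n by (simp_all add: M_def A_def)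
  have W0: "0 < W" using W_small by (cases W) auto
  \<comment> \<open>The program is the same for all word sizes and cannot contain the largest word
    as a constant; it obtains it by wrap-around.\<close>
  have s: "arith_op W Sub 0 1 = 2 ^ W - 1" by (simp add: arith_op.simps(2))
  show ?thesis
    unfolding init_com_def
    apply (rule wp_block)
    apply (simp add: w b m s W0 del: One_nat_def)
    apply (rule Q)
      apply (use t b in \<open>simp_all add: A_def\<close>)
    done
qed

lemma wp_power:
  assumes R: "R 2 = 1" "R 19 = n + 1"
    and Q: "Q (R(2 := P)) m"
    and t: "2 + 3 * k \<le> t"
  shows "wp W M power_com t Q R m"
proof -
  define I where "I j R' m' \<longleftrightarrow> j \<le> k \<and> R' = R(2 := 2 ^ (k - j)) \<and> m' = m" for j R' m'
  have kn: "(2::nat) ^ (k - 1) \<le> n"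
    using k n by (cases k) auto
  have 1: "R' 2 < R' 19 \<and> wp W M (Block [Arith Add 2 2 2]) 1 (I j) R' m'" if I: "I (Suc j) R' m'" for j R' m'
  proof
    have kj: "k - j = Suc (k - Suc j)" using I by (auto simp: I_def)
    have "(2::nat) ^ (k - Suc j) \<le> 2 ^ (k - 1)" by (intro power_increasing) auto
    then have le: "(2::nat) ^ (k - Suc j) \<le> n" using kn by linarith
    then show "R' 2 < R' 19" using I R by (simp add: I_def)
    have "(2::nat) ^ (k - Suc j) + 2 ^ (k - Suc j) < 2 ^ W" using le M_less by (simp add: M_def A_def)
    then show "wp W M (Block [Arith Add 2 2 2]) 1 (I j) R' m'"
      using I by (intro wp_block) (auto simp: I_def kj mult_2)
  qed
  have 2: "\<not> R' 2 < R' 19 \<and> Q R' m'" if "I 0 R' m'" for R' m'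
    using that R Q k by (auto simp: I_def P_def)
  have "wp W M power_com (k * (1 + 2) + 2) Q R m"
    unfolding power_com_def
    by (rule wp_while[where I = I, OF 1 2]) (use R in \<open>auto simp: I_def\<close>)
  then show ?thesis by (rule wp_time) (use t in simp)
qed

lemma wp_sum:
  assumes R: "std_regs R" "R 17 = 0" "R 18 = 0" and m: "input_mem m"
    and Q: "\<And>R'. std_regs R' \<Longrightarrow> R' 17 = N \<Longrightarrow> Q R' m"
    and t: "2 + 8 * n \<le> t"
  shows "wp W M sum_com t Q R m"
proof -
  define I where "I j R' m' \<longleftrightarrow> j \<le> n \<and> std_regs R' \<and> R' 17 = (\<Sum>i<n - j. p i) \<and> R' 18 = n - j \<and> m' = m"
    for j R' m'
  let ?body = "Block [Arith Add 7 18 18, Const 8 3, Arith Add 7 7 8, Load 8 7,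
     Arith Add 17 17 8, Arith Add 18 18 1]"
  have 1: "R' 18 < R' 14 \<and> wp W M ?body 6 (I j) R' m'" if I: "I (Suc j) R' m'" for j R' m'
  proof
    define s where "s = n - Suc j"
    have s: "n - Suc j = s" "n - j = Suc s" "s < n" using I by (auto simp: I_def s_def)
    show "R' 18 < R' 14" using I s by (simp add: I_def std_regs_def)
    have S: "(\<Sum>i<s. p i) + p s < 2 ^ W"
      using N_le'[of "Suc s", OF Suc_leI[OF s(3)]] pow_le[of 2] pow_pos[of 2] unfolding sum.lessThan_Suc by linarith
    have w: "3 mod 2 ^ W = (3::nat)" using W_small by simp
    have e: "m (s + s + 3) = p s" using m s by (simp add: input_mem_def)
    show "wp W M ?body 6 (I j) R' m'"
      using I s S bounds[OF s(3)] e
      by (intro wp_block) (auto simp: I_def w std_regs_def)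
  qed
  have 2: "\<not> R' 18 < R' 14 \<and> Q R' m'" if "I 0 R' m'" for R' m'
    using that Q by (auto simp: I_def std_regs_def N_def)
  have "wp W M sum_com (n * (6 + 2) + 2) Q R m"
    unfolding sum_com_def
    by (rule wp_while[where I = I, OF 1 2]) (use R in \<open>auto simp: I_def\<close>)
  then show ?thesis by (rule wp_time) (use t in simp)
qed

lemma wp_keys:
  assumes R: "std_regs R" "R 17 = N * N" "R 18 = 0" and m: "input_mem m"
    and Q: "\<And>R' m'. \<lbrakk>std_regs R'; R' 18 = n; eq_off {A + P..<A + 2 * P} m m';
       \<forall>i<n. m' (A + P + i) = key i\<rbrakk> \<Longrightarrow> Q R' m'"
    and t: "2 + 16 * n \<le> t"
  shows "wp W M keys_com t Q R m"
proof -
  define I where "I j R' m' \<longleftrightarrow> j \<le> n \<and> std_regs R' \<and> R' 17 = N * N \<and> R' 18 = n - j \<and>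
    eq_off {A + P..<A + 2 * P} m m' \<and> (\<forall>i<n - j. m' (A + P + i) = key i)"
    for j R' m'
  let ?body = "Block [Arith Add 7 18 18, Const 8 3, Arith Add 7 7 8, Load 9 7,
     Arith Add 7 7 1, Load 10 7, Arith Mul 10 10 17, Arith Div 10 10 9, Arith Mul 10 10 14,
     Arith Add 10 10 18, Arith Add 7 3 2, Arith Add 7 7 18, Store 7 10, Arith Add 18 18 1]"
  have 1: "R' 18 < R' 14 \<and> wp W M ?body 14 (I j) R' m'" if I: "I (Suc j) R' m'" for j R' m'
  proof
    define s where "s = n - Suc j"
    have s: "n - Suc j = s" "n - j = Suc s" "s < n" using I by (auto simp: I_def s_def)
    show "R' 18 < R' 14" using I s by (simp add: I_def std_regs_def)
    have w: "3 mod 2 ^ W = (3::nat)" using W_small by simp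
    have "input_mem m'"
      by (rule input_off[OF m, of "{A + P..<A + 2 * P}"]) (use I in \<open>auto simp: I_def\<close>)
    then have e: "m' (s + s + 3) = p s" "m' (s + s + 3 + 1) = q s" using s by (simp_all add: input_mem_def)
    have b1: "q s * (N * N) < 2 ^ W" using qN2[OF s(3)] pow_le[of 5] pow_pos[of 5] by linarith
    have b2: "q s * (N * N) div p s * n + s < 2 ^ W" using key_less[OF s(3)] by (simp add: key_def)
    then have b3: "q s * (N * N) div p s * n < 2 ^ W" by simp
    have b4: "A + P + s < 2 ^ W" "A + P < 2 ^ W" "A + P + s < M"
      using M_less s(3) nP unfolding M_def by linarith+
    have off: "eq_off {A + P..<A + 2 * P} m (m'(A + P + s := key s))"
      using I s nP by (intro eq_off_fun_upd) (auto simp: I_def)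
    have ks: "q s * (N * N) div p s * n + s = key s" by (simp add: key_def)
    have "I j (R'(7 := A + P + s, 8 := 3, 9 := p s, 10 := key s, 18 := s + 1)) (m'(A + P + s := key s))"
      using I off s unfolding I_def std_regs_def by (auto simp: less_Suc_eq)
    moreover have r: "R' 18 = s" "R' 1 = 1" "R' 2 = P" "R' 3 = A" "R' 14 = n" "R' 17 = N * N"
      using I s by (simp_all add: I_def std_regs_def)
    moreover have "s + s < 2 ^ W" "s + s + 3 < 2 ^ W" "s + s + 3 < M" using bounds[OF s(3)] by simp_all
    ultimately show "wp W M ?body 14 (I j) R' m'"
      using s bounds[OF s(3)] e b1 b2 b3 b4 ks
      by (intro wp_block) (simp_all add: w fun_upd_twist del: One_nat_def)
  qed
  have 2: "\<not> R' 18 < R' 14 \<and> Q R' m'" if "I 0 R' m'" for R' m'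
    using that Q by (auto simp: I_def std_regs_def)
  have "wp W M keys_com (n * (14 + 2) + 2) Q R m"
    unfolding keys_com_def
    by (rule wp_while[where I = I, OF 1 2]) (use R in \<open>auto simp: I_def\<close>)
  then show ?thesis by (rule wp_time) (use t in simp)
qed

lemma wp_pad:
  assumes R: "std_regs R" "R 18 = n"
    and Q: "\<And>R' m'. \<lbrakk>std_regs R'; eq_off {A + P + n..<A + 2 * P} m m';
       \<forall>i. n \<le> i \<and> i < P \<longrightarrow> m' (A + P + i) = 2 ^ W - 1\<rbrakk> \<Longrightarrow> Q R' m'"
    and t: "2 + 6 * P \<le> t"
  shows "wp W M pad_com t Q R m"
proof -
  define I where "I j R' m' \<longleftrightarrow> n + j \<le> P \<and> std_regs R' \<and> R' 18 = P - j \<and>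
    eq_off {A + P + n..<A + 2 * P} m m' \<and> (\<forall>i. n \<le> i \<and> i < P - j \<longrightarrow> m' (A + P + i) = 2 ^ W - 1)"
    for j R' m'
  let ?body = "Block [Arith Add 7 3 2, Arith Add 7 7 18, Store 7 6, Arith Add 18 18 1]"
  have 1: "R' 18 < R' 2 \<and> wp W M ?body 4 (I j) R' m'" if I: "I (Suc j) R' m'" for j R' m'
  proof
    define s where "s = P - Suc j"
    have s: "P - Suc j = s" "P - j = Suc s" "s < P" "n \<le> s" using I by (auto simp: I_def s_def)
    show "R' 18 < R' 2" using I s by (simp add: I_def std_regs_def)
    have b4: "A + P + s < 2 ^ W" "A + P < 2 ^ W" "A + P + s < M" "s + 1 < 2 ^ W"
      using M_less s(3) nP unfolding M_def A_def by linarith+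
    have off: "eq_off {A + P + n..<A + 2 * P} m (m'(A + P + s := 2 ^ W - 1))"
      using I s nP by (intro eq_off_fun_upd) (auto simp: I_def)
    have "I j (R'(7 := A + P + s, 18 := s + 1)) (m'(A + P + s := 2 ^ W - 1))"
      using I off s unfolding I_def std_regs_def by (auto simp: less_Suc_eq)
    moreover have r: "R' 18 = s" "R' 1 = 1" "R' 2 = P" "R' 3 = A" "R' 6 = 2 ^ W - 1"
      using I s by (simp_all add: I_def std_regs_def)
    ultimately show "wp W M ?body 4 (I j) R' m'"
      using b4 by (intro wp_block) (simp_all add: fun_upd_twist del: One_nat_def)
  qed
  have 2: "\<not> R' 18 < R' 2 \<and> Q R' m'" if "I 0 R' m'" for R' m'
    using that Q by (auto simp: I_def std_regs_def)
  have "wp W M pad_com ((P - n) * (4 + 2) + 2) Q R m"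
    unfolding pad_com_def
    by (rule wp_while[where I = I, OF 1 2]) (use R nP in \<open>auto simp: I_def\<close>)
  then show ?thesis by (rule wp_time) (use t in simp)
qed

lemma wp_leaves:
  assumes R: "std_regs R" "R 18 = 0" and tab: "tables P A \<gamma> \<tau> m"
    and small: "\<forall>l\<in>{P..<2 * P}. Suc (P + \<tau> l) < 2 ^ W"
    and Q: "\<And>R' m'. \<lbrakk>std_regs R'; tables P A \<gamma> \<tau> m';
       \<forall>l\<in>{P..<2 * P}. m' (A + l) = \<tau> l + P\<rbrakk> \<Longrightarrow> Q R' m'"
    and t: "2 + 10 * P \<le> t"
  shows "wp W M leaves_com t Q R m"
proof -
  define I where "I j R' m' \<longleftrightarrow> j \<le> P \<and> std_regs R' \<and> R' 18 = P - j \<and> tables P A \<gamma> \<tau> m' \<and>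
    (\<forall>i<P - j. m' (A + P + i) = \<tau> (P + i) + P)"
    for j R' m'
  let ?body = "Block [Arith Add 7 3 2, Arith Add 7 7 18, Arith Add 8 7 2, Arith Add 8 8 2, Load 9 8,
        Arith Add 9 9 2, Store 7 9, Arith Add 18 18 1]"
  have 1: "R' 18 < R' 2 \<and> wp W M ?body 8 (I j) R' m'" if I: "I (Suc j) R' m'" for j R' m'
  proof
    define s where "s = P - Suc j"
    have s: "P - Suc j = s" "P - j = Suc s" "s < P" using I by (auto simp: I_def s_def)
    show "R' 18 < R' 2" using I s by (simp add: I_def std_regs_def)
    have b4: "A + P + s < 2 ^ W" "A + P < 2 ^ W" "A + P + s + P < 2 ^ W" "A + P + s + P + P < 2 ^ W" 
      "A + P + s < M" "A + P + s + P + P < M" "s + 1 < 2 ^ W"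
      using M_less s(3) nP unfolding M_def A_def by linarith+
    have b5: "\<tau> (P + s) + P < 2 ^ W"
      using bspec[OF small, of "P + s"] s by simp
    have e: "A + P + s + P + P = A + 2 * P + (P + s)" by simp
    have ld: "m' (A + P + s + P + P) = \<tau> (P + s)"
      unfolding e using I s nP unfolding I_def tables_def by (metis atLeastLessThan_iff le_add1 mult_2 nat_add_left_cancel_less)
    have tab': "tables P A \<gamma> \<tau> (m'(A + P + s := \<tau> (P + s) + P))"
      using I s by (auto simp: I_def tables_def)
    have "I j (R'(7 := A + P + s, 8 := A + P + s + P + P, 9 := \<tau> (P + s) + P, 18 := s + 1))
        (m'(A + P + s := \<tau> (P + s) + P))"
      using I tab' s unfolding I_def std_regs_def by (auto simp: less_Suc_eq)
    moreover have r: "R' 18 = s" "R' 1 = 1" "R' 2 = P" "R' 3 = A"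
      using I s by (simp_all add: I_def std_regs_def)
    ultimately show "wp W M ?body 8 (I j) R' m'"
      using b4 b5 ld by (intro wp_block) (simp_all add: fun_upd_twist del: One_nat_def)
  qed
  have 2: "\<not> R' 18 < R' 2 \<and> Q R' m'" if I: "I 0 R' m'" for R' m'
  proof
    show "\<not> R' 18 < R' 2" using I by (auto simp: I_def std_regs_def)
    show "Q R' m'"
    proof (rule Q)
      show "\<forall>l\<in>{P..<2 * P}. m' (A + l) = \<tau> l + P"
      proof
        fix l assume "l \<in> {P..<2 * P}"
        then have "l - P < P" "P \<le> l" by auto
        then show "m' (A + l) = \<tau> l + P"
          using I[unfolded I_def, THEN conjunct2, THEN conjunct2, THEN conjunct2, THEN conjunct2, 
              THEN spec, of "l - P"] by simp
      qed
    qed (use I in \<open>auto simp: I_def\<close>)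
  qed
  have "wp W M leaves_com (P * (8 + 2) + 2) Q R m"
    unfolding leaves_com_def
    by (rule wp_while[where I = I, OF 1 2]) (use R tab in \<open>auto simp: I_def\<close>)
  then show ?thesis by (rule wp_time) (use t in simp)
qed


text \<open>The last clause expresses increasing order without gaps: it also forbids that a bamboo
  not yet output has a smaller key than one already output.\<close>

definition sorted_upto :: "nat \<Rightarrow> (nat \<Rightarrow> nat) \<Rightarrow> bool" where
  "sorted_upto s idx \<longleftrightarrow> (\<forall>t<s. idx t < n) \<and> inj_on idx {..<s} \<and>
     (\<forall>t<s. \<forall>j<n. key j < key (idx t) \<longrightarrow> (\<exists>t'<t. idx t' = j))"

text \<open>Padding leaves and extracted leaves look alike: both hold infinity, which lies above
  every key by \<open>key_less\<close>.\<close>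

definition remaining :: "nat \<Rightarrow> (nat \<Rightarrow> nat) \<Rightarrow> nat \<Rightarrow> nat" where
  "remaining s idx l =
     (if P \<le> l \<and> l - P < n \<and> l - P \<notin> idx ` {..<s} then key (l - P) else 2 ^ W - 1)"

lemma remaining_upd:
  "(remaining s idx)(P + i := 2 ^ W - 1) = remaining (Suc s) (idx(s := i))"
  by (rule ext) (auto simp: remaining_def lessThan_Suc)

text \<open>Sorting runs with day 0, where the window is the whole range of words and the modular
  comparison is the usual order.\<close>

lemma window_remaining: "window W P 0 (remaining s idx)"
proof -
  have "remaining s idx l < 2 ^ W" for l
    using key_less[of "l - P"] W_small by (auto simp: remaining_def)
  then show ?thesis by (simp add: window_def)
qed

text \<open>As \<open>s < n\<close>, some bamboo is left by counting, so the root is below infinity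
  and is a genuine key; every bamboo with a smaller key must have been extracted before.\<close>

lemma extract_min:
  assumes srt: "sorted_upto s idx" and s: "s < n"
  defines "i \<equiv> tree_min P (remaining s idx) 1 mod n"
  shows "i < n" "sorted_upto (Suc s) (idx(s := i))"
proof -
  let ?T = "tree_min P (remaining s idx) 1"
  have le: "?T \<le> remaining s idx (P + j)" if "j < P" for j
  proof -
    have "(P + j) div 2 ^ k = 1" using that by (simp add: P_def)
    then show ?thesis using tree_min_le[of "P + j" P k "remaining s idx"] that by simp
  qed
  have "card (idx ` {..<s}) < card {..<n}"
    using card_image_le[of "{..<s}" idx] s by simp
  then have "\<not> {..<n} \<subseteq> idx ` {..<s}"
    by (metis card_mono finite_imageI finite_lessThan not_less)
  then obtain j where "j < n" "j \<notin> idx ` {..<s}" by auto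
  then have "?T \<le> key j" "key j < 2 ^ W - 1"
    using le[of j] nP key_less by (auto simp: remaining_def)
  moreover obtain l where l: "l \<in> {P..<2 * P}" "?T = remaining s idx l"
    using tree_min_attained[of 1 P "remaining s idx"] nP by auto
  ultimately have l': "l - P < n" "l - P \<notin> idx ` {..<s}" "?T = key (l - P)"
    by (auto simp: remaining_def split: if_splits)
  then have i: "i = l - P" using key_mod by (simp add: i_def)
  show "i < n" using l' i by simp
  have min: "\<exists>t'<s. idx t' = j" if "j < n" "key j < key i" for j
  proof (rule ccontr)
    assume "\<not> (\<exists>t'<s. idx t' = j)"
    then have "remaining s idx (P + j) = key j" using that by (auto simp: remaining_def)
    then show False using le[of j] that l' i nP by simp
  qed
  have "\<exists>t'<t. (idx(s := i)) t' = j" if "t < Suc s" "j < n" "key j < key ((idx(s := i)) t)" for t j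
  proof -
    have "\<exists>t'<t. idx t' = j"
    proof (cases "t = s")
      case True
      then show ?thesis using that(2,3) min[of j] by simp
    next
      case False
      then have "t < s" "key j < key (idx t)" using that by simp_all
      then show ?thesis using that(2) srt[unfolded sorted_upto_def] by blast
    qed
    then obtain t' where "t' < t" "idx t' = j" by blast
    then show ?thesis using that(1) by (intro exI[of _ t']) simp
  qed
  moreover have "\<forall>t<Suc s. (idx(s := i)) t < n"
    using srt l'(1) i unfolding sorted_upto_def by (simp add: less_Suc_eq)
  moreover have "inj_on (idx(s := i)) {..<Suc s}"
  proof -
    have "inj_on (idx(s := i)) {..<s}"
      using srt l'(2) unfolding sorted_upto_def i by (intro inj_on_fun_updI) simp_all
    moreover have "(idx(s := i)) ` {..<s} = idx ` {..<s}" by auto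
    ultimately show ?thesis using l'(2) unfolding lessThan_Suc i by simp
  qed
  ultimately show "sorted_upto (Suc s) (idx(s := i))"
    unfolding sorted_upto_def by blast
qed

text \<open>Only the \<open>n\<close> table entries of bamboos are written. The entries of padding
  leaves rely on \<open>zero\<close>: untouched memory already holds answer 0 and waiting time
  0.\<close>

lemma wp_extract:
  assumes R: "std_regs R" "R 18 = 0" and m: "input_mem m" "tree_mem W P A (remaining 0 id) m"
    and zero: "\<forall>a\<ge>A + 2 * P. m a = 0"
    and Q: "\<And>R' m' idx. \<lbrakk>std_regs R'; sorted_upto n idx;
       tables P A (\<lambda>l. if l - P < n then idx (l - P) + 1 else 0)
         (\<lambda>l. if l - P < n then wait (idx (l - P)) else 0) m'\<rbrakk> \<Longrightarrow> Q R' m'"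
    and t: "2 + n * (28 + 14 * k) \<le> t"
  shows "wp W M extract_com t Q R m"
proof -
  define I where "I j R' m' \<longleftrightarrow> j \<le> n \<and> std_regs R' \<and> R' 18 = n - j \<and> input_mem m' \<and>
    (\<exists>idx. sorted_upto (n - j) idx \<and> tree_mem W P A (remaining (n - j) idx) m' \<and>
      (\<forall>t<P. m' (A + 2 * P + t) = (if t < n - j then idx t + 1 else 0) \<and>
        m' (A + 3 * P + t) = (if t < n - j then wait (idx t) else 0)))"
    for j R' m'
  let ?blk = "[Arith Add 7 3 1, Load 7 7, Arith Mod 5 7 14,
        Arith Add 9 3 2, Arith Add 9 9 2, Arith Add 9 9 18, Arith Add 8 5 1, Store 9 8,
        Arith Add 9 9 2, Arith Add 8 5 5, Const 10 3, Arith Add 8 8 10, Load 12 8,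
        Arith Add 8 8 1, Load 13 8, Arith Mul 13 15 13, Arith Sub 13 13 1, Arith Mul 12 16 12,
        Arith Div 13 13 12, Store 9 13, Arith Add 5 5 2]"
  let ?rest = "Seq update (Block [Arith Add 18 18 1])"
  have 1: "R' 18 < R' 14 \<and> wp W M (Seq (Block ?blk) ?rest) (26 + 14 * k) (I j) R' m'"
    if I: "I (Suc j) R' m'" for j R' m'
  proof
    define s where "s = n - Suc j"
    have s: "n - Suc j = s" "n - j = Suc s" "s < n" using I by (auto simp: I_def s_def)
    show "R' 18 < R' 14" using I s by (simp add: I_def std_regs_def)
    obtain idx where idx: "sorted_upto s idx" "tree_mem W P A (remaining s idx) m'"
      "\<And>t. t < P \<Longrightarrow> m' (A + 2 * P + t) = (if t < s then idx t + 1 else 0) \<and>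
        m' (A + 3 * P + t) = (if t < s then wait (idx t) else 0)"
      using I s unfolding I_def by auto
    define T where "T = tree_min P (remaining s idx) 1"
    define i where "i = T mod n"
    have i: "i < n" "sorted_upto (Suc s) (idx(s := i))"
      using extract_min[OF idx(1) s(3)] by (simp_all add: i_def T_def)
    have Tl: "m' (A + 1) = T"
      using idx(2)[unfolded tree_mem_def, THEN spec, of 1] nP
        tree_min_window[of P 0 "remaining s idx" "2 ^ W" 1] window_remaining[of s idx]
      by (simp add: T_def window_def)
    have w: "3 mod 2 ^ W = (3::nat)" using W_small by simp
    have r: "R' 18 = s" "R' 1 = 1" "R' 2 = P" "R' 3 = A" "R' 14 = n" "R' 15 = xp" "R' 16 = xq"
      using I s by (simp_all add: I_def std_regs_def)
    let ?c = "A + P + P + s"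
    let ?m = "m'(?c := i + 1, ?c + P := wait i)"
    have b: "A + 1 < 2 ^ W" "A + P < 2 ^ W" "A + P + P < 2 ^ W" "?c < 2 ^ W" "?c + P < 2 ^ W"
      "i + 1 < 2 ^ W" "i + i < 2 ^ W" "i + i + 3 < 2 ^ W" "i + i + 3 + 1 < 2 ^ W" "i + P < 2 ^ W" "s + 1 < 2 ^ W"
      "A + 1 < M" "?c < M" "?c + P < M" "i + i + 3 < M" "i + i + 3 + 1 < M"
      "i + i + 3 \<noteq> ?c" "i + i + 3 + 1 \<noteq> ?c"
      using M_less nP i(1) s unfolding M_def A_def by linarith+
    have e: "m' (i + i + 3) = p i" "m' (i + i + 3 + 1) = q i"
      using I i(1) by (simp_all add: I_def input_mem_def)
    have mul: "xp * q i < 2 ^ W" "xq * p i < 2 ^ W" "0 < xp * q i"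
      using xq_le[OF i(1)] xq_le'[OF i(1)] pow_le[of 2] pow_pos[of 2] xp pq[OF i(1)] by (linarith, linarith, simp)
    have sub: "arith_op W Sub (xp * q i) 1 = xp * q i - 1"
      using mul by (intro arith_Sub) auto
    have wt: "(xp * q i - 1) div (xq * p i) = wait i" by (simp add: wait_def)
    let ?R = "R'(7 := T, 5 := i + P, 9 := ?c + P, 8 := i + i + 3 + 1, 10 := 3, 12 := xq * p i, 13 := wait i)"
    have upd: "wp W M ?rest (5 + 14 * k) (I j) ?R ?m"
    proof (rule wp_seq[where t = "4 + 14 * k"], rule wp_update[where k = k])
      show "base_regs W P A 0 ?R" using r I by (simp add: base_regs_def I_def std_regs_def)
      show "?R 5 = P + i" by simp
      show "?R 6 = (2 ^ W - 1) mod 2 ^ W" using I by (simp add: I_def std_regs_def)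
      show "window W P 0 ((remaining s idx)(P + i := 2 ^ W - 1))"
        unfolding remaining_upd by (rule window_remaining)
      show "tree_mem W P A (remaining s idx) ?m"
        using idx(2) by (auto simp: tree_mem_def)
      fix R'' m''
      assume R'': "eq_off scratch ?R R''" and m'': "eq_off {A..<A + 2 * P} ?m m''"
        "tree_mem W P A ((remaining s idx)(P + i := 2 ^ W - 1)) m''"
      have "std_regs ?R" using I by (simp add: I_def std_regs_def)
      then have std: "std_regs R''"
        by (rule std_off[OF _ R'']) (auto simp: scratch_def)
      have R18: "R'' 18 = s" "R'' 1 = 1" using R'' r by (simp_all add: eq_off_def scratch_def)
      have inp: "input_mem m''"
      proof (rule input_off[of m' "{A..}"])
        show "eq_off {A..} m' m''" using m''(1) by (auto simp: eq_off_def)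
      qed (use I in \<open>auto simp: I_def\<close>)
      have tb: "m'' (A + 2 * P + t) = (if t < Suc s then (idx(s := i)) t + 1 else 0) \<and>
        m'' (A + 3 * P + t) = (if t < Suc s then wait ((idx(s := i)) t) else 0)" if "t < P" for t
      proof -
        have "m'' (A + 2 * P + t) = ?m (A + 2 * P + t)" "m'' (A + 3 * P + t) = ?m (A + 3 * P + t)"
          using m''(1) by (auto simp: eq_off_def)
        moreover have "A + 2 * P + t \<noteq> ?c + P" "A + 3 * P + t \<noteq> ?c" using that s nP by linarith+
        moreover have "A + 2 * P + t = ?c \<longleftrightarrow> t = s" "A + 3 * P + t = ?c + P \<longleftrightarrow> t = s" by auto
        ultimately show ?thesis using idx(3)[OF that] by (simp add: less_Suc_eq)
      qed
      have "I j (R''(18 := s + 1)) m''"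
        unfolding I_def
      proof (intro conjI exI)
        show "sorted_upto (n - j) (idx(s := i))" unfolding s(2) by (rule i(2))
        show "tree_mem W P A (remaining (n - j) (idx(s := i))) m''"
          unfolding s(2) using m''(2) unfolding remaining_upd .
        show "\<forall>t<P. m'' (A + 2 * P + t) = (if t < n - j then (idx(s := i)) t + 1 else 0) \<and>
        m'' (A + 3 * P + t) = (if t < n - j then wait ((idx(s := i)) t) else 0)"
          unfolding s(2) using tb by blast
        show "std_regs (R''(18 := s + 1))" using std by (simp add: std_regs_def)
      qed (use I inp s in \<open>auto simp: I_def\<close>)
      then show "wp W M (Block [Arith Add 18 18 1]) (5 + 14 * k - (4 + 14 * k)) (I j) R'' m''"
        using R18 b by (intro wp_block) simp_all
    next
      show "P = 2 ^ k" by (rule P_def)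
      show "P \<le> P + i" "P + i < 2 * P" using i(1) nP by simp_all
      show "A + 2 * P \<le> M" "M \<le> 2 ^ W" "2 < M" using M_less layout by linarith+
    qed simp_all
    show "wp W M (Seq (Block ?blk) ?rest) (26 + 14 * k) (I j) R' m'"
    proof (rule wp_block_seq)
      have len: "26 + 14 * k - length ?blk = 5 + 14 * k" by simp
      show "block_wp W M ?blk (wp W M ?rest (26 + 14 * k - length ?blk) (I j)) R' m'"
        unfolding len
        using b mul e sub wt Tl upd 
        by (simp add: r w i_def[symmetric] fun_upd_twist del: One_nat_def)
    qed simp
  qed
  have 2: "\<not> R' 18 < R' 14 \<and> Q R' m'" if I: "I 0 R' m'" for R' m'
  proof
    show "\<not> R' 18 < R' 14" using I by (auto simp: I_def std_regs_def)
    obtain idx where idx: "sorted_upto n idx"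
      "\<And>t. t < P \<Longrightarrow> m' (A + 2 * P + t) = (if t < n then idx t + 1 else 0) \<and>
        m' (A + 3 * P + t) = (if t < n then wait (idx t) else 0)"
      using I unfolding I_def by auto
    show "Q R' m'"
    proof (rule Q[OF _ idx(1)])
      show "std_regs R'" using I by (simp add: I_def)
      show "tables P A (\<lambda>l. if l - P < n then idx (l - P) + 1 else 0)
         (\<lambda>l. if l - P < n then wait (idx (l - P)) else 0) m'"
        unfolding tables_def
      proof
        fix l assume "l \<in> {P..<2 * P}"
        then have "l - P < P" and e: "A + P + l = A + 2 * P + (l - P)" "A + 2 * P + l = A + 3 * P + (l - P)"
          by auto
        show "m' (A + P + l) = (if l - P < n then idx (l - P) + 1 else 0) \<and>
          m' (A + 2 * P + l) = (if l - P < n then wait (idx (l - P)) else 0)"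
          unfolding e by (rule idx(2)[OF \<open>l - P < P\<close>])
      qed
    qed
  qed
  have "wp W M extract_com (n * (26 + 14 * k + 2) + 2) Q R m"
    unfolding extract_com_def
  proof (rule wp_while[where I = I, OF 1 2])
    have "sorted_upto 0 id" by (simp add: sorted_upto_def)
    moreover have "m (A + 2 * P + t) = 0 \<and> m (A + 3 * P + t) = 0" for t
      using zero by simp
    ultimately show "I n R m"
      unfolding I_def using R m by (intro conjI exI[of _ id]) simp_all
  qed
  then show ?thesis by (rule wp_time) (use t in \<open>simp add: algebra_simps\<close>)
qed


lemma P_pow: "P = 2 ^ k" by (simp add: P_def)

text \<open>
  Since \<open>n < P\<close> there is a padding leaf. It is ready every day and has the answer \<open>0\<close>, so that
  ``do nothing'' needs no special case.
\<close>

definition leaf_code :: "(nat \<Rightarrow> nat) \<Rightarrow> nat \<Rightarrow> nat" where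
  "leaf_code idx l = (if l - P < n then idx (l - P) + 1 else 0)"

definition leaf_wait :: "(nat \<Rightarrow> nat) \<Rightarrow> nat \<Rightarrow> nat" where
  "leaf_wait idx l = (if l - P < n then wait (idx (l - P)) else 0)"

lemma leaf_wait_small: "sorted_upto n idx \<Longrightarrow> \<forall>l\<in>{P..<2 * P}. Suc (P + leaf_wait idx l) < 2 ^ W"
  using wait_small M_less by (auto simp: leaf_wait_def sorted_upto_def M_def A_def)

text \<open>The tree is built twice, for the sorting keys and for the days, in linear time each. The
  term \<open>14 * k\<close> per bamboo, from the path update after each extraction, is the only
  superlinear one.\<close>

lemma wp_build:
  assumes m: "m 0 = n" "m 1 = xp" "m 2 = xq" "input_mem m" "\<forall>a\<ge>A. m a = 0"
    and Q: "\<And>R' m' idx. \<lbrakk>sorted_upto n idx; base_regs W P A 0 R';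
       tree_mem W P A (\<lambda>l. leaf_wait idx l + P) m'; tables P A (leaf_code idx) (leaf_wait idx) m'\<rbrakk> \<Longrightarrow> Q R' m'"
    and t: "40 + 3 * k + 42 * P + n * (52 + 14 * k) \<le> t"
  shows "wp W M build_com t Q R m"
proof -
  \<comment> \<open>Naming the product makes all remaining time obligations linear.\<close>
  define u where "u = n * (28 + 14 * k)"
  have t': "40 + 3 * k + 42 * P + 24 * n + u \<le> t" using t by (simp add: u_def algebra_simps)
  note ar = t' u_def[symmetric]
  have AP: "A + 2 * P \<le> M" "M \<le> 2 ^ W" using M_less layout by linarith+
  show ?thesis
    unfolding build_com_def
  proof (rule wp_seq[where t = 16], rule wp_init[OF m(1-3)], goal_cases)
    case (1 R1)
    let ?R1 = "R1(2 := P)"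
    have std1: "std_regs ?R1" "?R1 17 = 0" "?R1 18 = 0" using 1 by (simp_all add: std_regs_def)
    have "wp W M (Seq sum_com (Seq (Block [Arith Mul 17 17 17, Const 18 0])
      (Seq keys_com (Seq pad_com (Seq build_tree (Seq (Block [Const 18 0])
      (Seq extract_com (Seq (Block [Const 18 0]) (Seq leaves_com build_tree)))))))))
      (t - 16 - (2 + 3 * k)) Q ?R1 m"
    proof (rule wp_seq[where t = "2 + 8 * n"], rule wp_sum[OF std1 m(4)], goal_cases)
      case (1 R2)
      have NN: "N * N < 2 ^ W" using N2 pow_le[of 4] pow_pos[of 4] by linarith
      let ?R2 = "R2(17 := N * N, 18 := 0)"
      have std2: "std_regs ?R2" "?R2 17 = N * N" "?R2 18 = 0" using 1 by (simp_all add: std_regs_def)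
      have "wp W M (Seq keys_com (Seq pad_com (Seq build_tree (Seq (Block [Const 18 0])
         (Seq extract_com (Seq (Block [Const 18 0]) (Seq leaves_com build_tree)))))))
         (t - 16 - (2 + 3 * k) - (2 + 8 * n) - 2) Q ?R2 m"
      proof (rule wp_seq[where t = "2 + 16 * n"], rule wp_keys[OF std2 m(4)], goal_cases)
        case (1 R3 m3)
        note keys = 1
        show ?case
        proof (rule wp_seq[where t = "2 + 6 * P"], rule wp_pad[OF 1(1,2)], goal_cases)
          case (1 R4 m4)
          have m4: "m4 (A + l) = remaining 0 id l mod 2 ^ W" if "l \<in> {P..<2 * P}" for l
          proof -
            have l: "l - P < P" "A + l = A + P + (l - P)" using that by auto
            show ?thesis
            proof (cases "l - P < n")
              case True
              then have "m4 (A + l) = m3 (A + P + (l - P))"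
                using 1(2) l(2) that by (auto simp: eq_off_def)
              then show ?thesis
                using keys(4) True that key_less[OF True] by (simp add: remaining_def)
            next
              case False
              then have "m4 (A + P + (l - P)) = 2 ^ W - 1" using 1(3) l(1) by simp
              then show ?thesis unfolding l(2) using False by (simp add: remaining_def)
            qed
          qed
          have off4: "eq_off {A..<A + 2 * P} m m4"
          proof (rule eq_off_trans)
            show "eq_off {A..<A + 2 * P} m m3" by (rule eq_off_mono[OF keys(3)]) auto
            show "eq_off {A..<A + 2 * P} m3 m4" by (rule eq_off_mono[OF 1(2)]) auto
          qed
          show ?case
          proof (rule wp_seq[where t = "4 + 13 * P"],
              rule wp_build_tree[OF std_base[OF 1(1)] nP(3) AP window_remaining[of 0 id]], goal_cases)
            case 1
            then show ?case using m4 by blast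
          next
            case (2 R5 m5)
            have off5: "eq_off {A..<A + 2 * P} m m5"
              by (rule eq_off_trans[OF off4 eq_off_mono[OF 2(2)]]) auto
            have std5: "std_regs (R5(18 := 0))" "(R5(18 := 0)) 18 = 0"
              using std_off[OF \<open>std_regs R4\<close> 2(1)] by (simp_all add: std_regs_def scratch_def)
            have inp5: "input_mem m5" by (rule input_off[OF m(4) off5]) auto
            have zero5: "\<forall>a\<ge>A + 2 * P. m5 a = 0" using off5 m(5) by (auto simp: eq_off_def)
            have "wp W M (Seq extract_com (Seq (Block [Const 18 0]) (Seq leaves_com build_tree)))
              (t - 16 - (2 + 3 * k) - (2 + 8 * n) - 2 - (2 + 16 * n) - (2 + 6 * P) - (4 + 13 * P) - 1)
              Q (R5(18 := 0)) m5"
            proof (rule wp_seq[where t = "2 + u"],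
                rule wp_extract[OF std5 inp5 2(3) zero5, folded leaf_code_def leaf_wait_def], goal_cases)
              case (1 R6 m6 idx)
              have tab6: "tables P A (leaf_code idx) (leaf_wait idx) m6"
                using 1(3) by (simp add: leaf_code_def[abs_def] leaf_wait_def[abs_def])
              have std6: "std_regs (R6(18 := 0))" "(R6(18 := 0)) 18 = 0"
                using 1(1) by (simp_all add: std_regs_def)
              note srt = 1(2)
              have "wp W M (Seq leaves_com build_tree) (t - 16 - (2 + 3 * k) - (2 + 8 * n) - 2 -
                 (2 + 16 * n) - (2 + 6 * P) - (4 + 13 * P) - 1 - (2 + u) - 1) Q (R6(18 := 0)) m6"
              proof (rule wp_seq[where t = "2 + 10 * P"],
                  rule wp_leaves[OF std6 tab6 leaf_wait_small[OF srt]], goal_cases)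
                case (1 R7 m7)
                show ?case
                proof (rule wp_build_tree[where f = "\<lambda>l. leaf_wait idx l + P", OF std_base[OF 1(1)] nP(3) AP], goal_cases)
                  case 1
                  show "window W P 0 (\<lambda>l. leaf_wait idx l + P)"
                    using leaf_wait_small[OF srt] by (auto simp: window_def add.commute)
                next
                  case 2
                  then show ?case using 1(3) leaf_wait_small[OF srt] by (auto simp: add.commute)
                next
                  case (3 R8 m8)
                  have base8: "base_regs W P A 0 R8"
                    by (rule eq_off_base_regs[OF 3(1) _ std_base[OF 1(1)]]) (simp add: scratch_def)
                  have "tables P A (leaf_code idx) (leaf_wait idx) m8"
                    using 1(2) 3(2) by (auto simp: tables_def eq_off_def)
                  then show ?case by (rule Q[OF srt base8 3(3)])
                qed (use ar in simp)
              qed (use ar in simp_all)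
              then show ?case using ar by (intro wp_block_seq) simp_all
            qed (use ar in simp_all)
            then show ?case using ar by (intro wp_block_seq) simp_all
          qed (use ar in simp_all)
        qed (use ar in simp_all)
      qed (use ar in simp_all)
      then show ?case using 1 NN ar by (intro wp_block_seq) simp_all
    qed (use ar in simp_all)
    note rest = this
    show ?case
      by (rule wp_seq[where t = "2 + 3 * k"], rule wp_power) (use 1 ar rest in simp_all)
  qed (use ar in simp_all)
qed

end

section \<open>Correctness of the schedule\<close>

text \<open>The day after the last trimming before day \<open>D\<close>.\<close>

definition last_reset :: "schedule \<Rightarrow> nat \<Rightarrow> nat \<Rightarrow> nat" where
  "last_reset trim D i =
     (if \<exists>d<D. trim d = Some i then Suc (Max {d. d < D \<and> trim d = Some i}) else 0)"

lemma last_reset_0 [simp]: "last_reset trim 0 i = 0"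
  by (simp add: last_reset_def)

lemma last_reset_Suc:
  "last_reset trim (Suc D) i = (if trim D = Some i then Suc D else last_reset trim D i)"
proof (cases "trim D = Some i")
  case True
  then have "Max {d. d < Suc D \<and> trim d = Some i} = D"
    by (intro Max_eqI) auto
  then show ?thesis using True by (auto simp: last_reset_def)
next
  case False
  then have "{d. d < Suc D \<and> trim d = Some i} = {d. d < D \<and> trim d = Some i}"
    by (auto simp: less_Suc_eq)
  moreover have "(\<exists>d<Suc D. trim d = Some i) \<longleftrightarrow> (\<exists>d<D. trim d = Some i)"
    using False by (auto simp: less_Suc_eq)
  ultimately show ?thesis using False by (simp add: last_reset_def)
qed

lemma last_reset_le: "last_reset trim D i \<le> D"
  by (induction D) (auto simp: last_reset_Suc)

lemma height_last_reset: "height h trim D i = h i * real (D + 1 - last_reset trim D i)"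
  by (cases "\<exists>d<D. trim d = Some i")
    (simp_all only: height_def last_reset_def if_True if_False, simp_all)

text \<open>
  \<open>L l\<close> is the day after the last trimming of leaf \<open>l\<close>. Sweeping may falsify the key of a leaf, but
  only of one that is ready and stays ready.
\<close>

definition sched_ok ::
  "nat \<Rightarrow> (nat \<Rightarrow> nat) \<Rightarrow> (nat \<Rightarrow> nat) \<Rightarrow> nat \<Rightarrow> (nat \<Rightarrow> nat) \<Rightarrow> bool" where
  "sched_ok P \<tau> L D f \<longleftrightarrow> (\<forall>l\<in>{P..<2 * P}. L l \<le> D \<and>
     (f l = L l + \<tau> l + P \<or> f l \<le> D + P \<and> L l + \<tau> l \<le> D))"

text \<open>An exact key decides readiness by comparison with \<open>D + P\<close>; for an inexact
  one both sides are true.\<close>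

lemma sched_ok_ready:
  "sched_ok P \<tau> L D f \<Longrightarrow> l \<in> {P..<2 * P} \<Longrightarrow> f l \<le> D + P \<longleftrightarrow> L l + \<tau> l \<le> D"
  unfolding sched_ok_def by fastforce

text \<open>The trimmed leaf gets an exact key. The sweep changes a key only if it is below
  \<open>D + P\<close>, that is, for a ready leaf, and the raised key stays below the threshold of
  the next day.\<close>

lemma sched_ok_next:
  assumes ok: "sched_ok P \<tau> L D f"
  shows "sched_ok P \<tau> (L(l := Suc D)) (Suc D) (next_keys P \<tau> D l f)"
  unfolding sched_ok_def
proof
  fix i assume "i \<in> {P..<2 * P}"
  then have "L i \<le> D" "f i = L i + \<tau> i + P \<or> f i \<le> D + P \<and> L i + \<tau> i \<le> D"
    using ok by (auto simp: sched_ok_def)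
  then show "(L(l := Suc D)) i \<le> Suc D \<and>
     (next_keys P \<tau> D l f i = (L(l := Suc D)) i + \<tau> i + P \<or>
      next_keys P \<tau> D l f i \<le> Suc D + P \<and> (L(l := Suc D)) i + \<tau> i \<le> Suc D)"
    by (auto simp: next_keys_def Let_def max_def)
qed

text \<open>Distinct fractions with denominators at most \<open>N\<close> differ by at least
  \<open>1 / (b * d)\<close>, hence by at least \<open>1 / (N * N)\<close>; after scaling the gap is
  at least 1 and survives rounding down.\<close>

lemma scaled_div_less:
  fixes a b c d N :: nat
  assumes "a * d < c * b" "b \<le> N" "d \<le> N" "0 < b" "0 < d"
  shows "a * (N * N) div b < c * (N * N) div d"
proof -
  let ?F = "a * (N * N) div b"
  have "(?F + 1) * d * b = ?F * b * d + b * d" by (simp add: algebra_simps)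
  also have "\<dots> \<le> a * (N * N) * d + N * N"
    using assms by (intro add_mono mult_le_mono1 mult_le_mono div_times_less_eq_dividend) auto
  also have "\<dots> = (a * d + 1) * (N * N)" by (simp add: algebra_simps)
  also have "\<dots> \<le> c * b * (N * N)" using assms(1) by (intro mult_le_mono1) simp
  finally have "(?F + 1) * d * b \<le> c * (N * N) * b" by (simp add: algebra_simps)
  then have "(?F + 1) * d \<le> c * (N * N)" using assms(4) by (simp only: mult_le_cancel2)
  then have "?F + 1 \<le> c * (N * N) div d" using assms(5) by (simp add: less_eq_div_iff_mult_less_eq)
  then show ?thesis by simp
qed

section \<open>From integer keys and waiting times back to rates and heights\<close>

context garden
begin

lemma p_le_N: "i < n \<Longrightarrow> p i \<le> N"
  unfolding N_def by (rule member_le_sum) auto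

text \<open>Keys approximate the reciprocal rates, so increasing keys mean decreasing rates. The
  numerators \<open>p\<close> of the rates are the denominators here, which is why their sum
  \<open>N\<close> sets the scale.\<close>

lemma key_order:
  assumes "a < n" "b < n" "key a \<le> key b"
  defines "h \<equiv> \<lambda>i. real (p i) / real (q i)"
  shows "h b < h a \<or> h a = h b \<and> a \<le> b"
proof -
  have pa: "0 < p a" "0 < q a" "p a \<le> N" and pb: "0 < p b" "0 < q b" "p b \<le> N"
    using pq assms(1,2) p_le_N by auto
  have h: "h b < h a \<longleftrightarrow> q a * p b < q b * p a" "h a = h b \<longleftrightarrow> q a * p b = q b * p a"
  proof -
    have "h b < h a \<longleftrightarrow> real (q a * p b) < real (q b * p a)"
      using pa pb by (simp add: h_def field_simps)
    then show "h b < h a \<longleftrightarrow> q a * p b < q b * p a" by (simp only: of_nat_less_iff)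
    have "h a = h b \<longleftrightarrow> real (q a * p b) = real (q b * p a)"
      using pa pb by (auto simp add: h_def field_simps)
    then show "h a = h b \<longleftrightarrow> q a * p b = q b * p a" by (simp only: of_nat_eq_iff)
  qed
  consider "q a * p b < q b * p a" | "q b * p a < q a * p b" | "q a * p b = q b * p a" by linarith
  then show ?thesis
  proof cases
    case 1
    then show ?thesis using h by blast
  next
    case 2
    let ?F = "\<lambda>i. q i * (N * N) div p i"
    have "?F b + 1 \<le> ?F a" using scaled_div_less[OF 2 pb(3) pa(3) pb(1) pa(1)] by simp
    then have "(?F b + 1) * n \<le> ?F a * n" by (rule mult_le_mono1)
    then have "key b < key a" using assms(2) by (simp add: key_def)
    then show ?thesis using assms(3) by simp
  next
    case 3
    \<comment> \<open>Equal rates may be given by different pairs; expanding both quotients to the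
      denominator \<open>p a * p b\<close> shows that they round alike, so the index
      decides.\<close>
    have "q a * (N * N) div p a = (q a * (N * N) * p b) div (p a * p b)" using pb(1) by simp
    also have "q a * (N * N) * p b = q b * (N * N) * p a" using 3 by (metis mult.assoc mult.commute)
    also have "\<dots> div (p a * p b) = q b * (N * N) div p b" using pa(1) by (simp add: mult.commute[of "p a"])
    finally show ?thesis using assms(3) 3 h by (simp add: key_def)
  qed
qed

text \<open>The height on day \<open>D\<close> already counts \<open>D + 1 - L\<close> days of
  growth, so readiness starts one day earlier than the rounded up quotient suggests. Subtracting 1
  from the numerator before dividing gives this number also when the quotient is an integer.\<close>

lemma wait_iff:
  assumes "i < n" "L \<le> D"
  shows "real xp / real xq \<le> real (p i) / real (q i) * real (D + 1 - L) \<longleftrightarrow> L + wait i \<le> D"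
proof -
  let ?d = "D + 1 - L"
  have pos: "0 < p i" "0 < q i" using pq assms by auto
  have "real xp / real xq \<le> real (p i) / real (q i) * real ?d \<longleftrightarrow>
      real (xp * q i) \<le> real (?d * (xq * p i))"
    using pos xq by (simp add: field_simps)
  also have "\<dots> \<longleftrightarrow> xp * q i \<le> ?d * (xq * p i)" by (rule of_nat_le_iff)
  also have "\<dots> \<longleftrightarrow> xp * q i - 1 < ?d * (xq * p i)"
    using xp pos by (metis Suc_le_eq Suc_diff_1 nat_0_less_mult_iff)
  also have "\<dots> \<longleftrightarrow> wait i < ?d"
    unfolding wait_def using pos xq by (simp add: div_less_iff_less_mult)
  also have "\<dots> \<longleftrightarrow> L + wait i \<le> D" using assms(2) by linarith
  finally show ?thesis .
qed

text \<open>Leaves are ordered by decreasing rate and, for equal rates, by index, so the leftmost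
  ready leaf is the prescribed choice. All padding leaves lie to the right of the bamboos; if one of
  them is the leftmost ready leaf, no bamboo is ready.\<close>

lemma fastest_choice_leaf:
  fixes L :: "nat \<Rightarrow> nat"
  assumes srt: "sorted_upto n idx" and h: "\<And>i. i < n \<Longrightarrow> h i = real (p i) / real (q i)"
    and x: "x = real xp / real xq"
    and L: "\<And>t. t < n \<Longrightarrow> L (P + t) = last_reset trim D (idx t)"
    and l: "P \<le> l" "l < 2 * P" "L l + leaf_wait idx l \<le> D" "\<forall>i\<in>{P..<l}. D < L i + leaf_wait idx i"
  shows "fastest_choice n h x (height h trim D) =
    (if leaf_code idx l = 0 then None else Some (leaf_code idx l - 1))"
proof -
  have surj: "\<exists>t<n. idx t = i" if "i < n" for i
  proof -
    have "idx ` {..<n} = {..<n}"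
      by (rule card_subset_eq) (use srt in \<open>auto simp: sorted_upto_def card_image\<close>)
    then have "i \<in> idx ` {..<n}" using that by simp
    then show ?thesis by auto
  qed
  have lt: "idx t < n" if "t < n" for t using that srt by (simp add: sorted_upto_def)
  have hx: "x \<le> height h trim D (idx t) \<longleftrightarrow> L (P + t) + leaf_wait idx (P + t) \<le> D" if "t < n" for t
    unfolding height_last_reset x h[OF lt[OF that]]
    using wait_iff[OF lt[OF that] last_reset_le] L[OF that] that by (simp add: leaf_wait_def)
  have srt3: "\<exists>t'<t. idx t' = j" if "t < n" "j < n" "key j < key (idx t)" for t j
    using that srt unfolding sorted_upto_def by blast
  have ord: "h (idx t') < h (idx t) \<or> h (idx t) = h (idx t') \<and> idx t \<le> idx t'"
    if tt: "t \<le> t'" "t' < n" for t t'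
  proof -
    have "key (idx t) \<le> key (idx t')"
    proof (rule ccontr)
      assume "\<not> ?thesis"
      then obtain t'' where t'': "t'' < t" "idx t'' = idx t'"
        using srt3[of t "idx t'"] tt lt[of t'] by auto
      have "inj_on idx {..<n}" using srt by (simp add: sorted_upto_def)
      then have "t'' = t'" by (rule inj_onD) (use t'' that in auto)
      then show False using t'' that by simp
    qed
    then show ?thesis using key_order[of "idx t" "idx t'"] lt that h by simp
  qed
  show ?thesis
  proof (cases "l - P < n")
    case True
    let ?s = "l - P"
    have s: "?s < n" "P + ?s = l" using True l by auto
    have ready: "x \<le> height h trim D (idx ?s)" using hx[OF s(1)] l s(2) by simp
    have after: "?s \<le> t" if "t < n" "x \<le> height h trim D (idx t)" for t
    proof (rule ccontr)
      assume "\<not> ?s \<le> t"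
      then have "P + t \<in> {P..<l}" by auto
      then show False using l(4) hx[OF that(1)] that(2) by fastforce
    qed
    have "(LEAST i. i < n \<and> x \<le> height h trim D i \<and>
       (\<forall>j<n. x \<le> height h trim D j \<longrightarrow> h j \<le> h i)) = idx ?s"
    proof (rule Least_equality)
      show "idx ?s < n \<and> x \<le> height h trim D (idx ?s) \<and>
         (\<forall>j<n. x \<le> height h trim D j \<longrightarrow> h j \<le> h (idx ?s))"
        using lt s ready after ord surj by (metis less_eq_real_def order_refl)
    next
      fix i assume i: "i < n \<and> x \<le> height h trim D i \<and>
         (\<forall>j<n. x \<le> height h trim D j \<longrightarrow> h j \<le> h i)"
      then obtain t where t: "t < n" "idx t = i" using surj by blast
      then have "?s \<le> t" using after i by blast
      moreover have "h (idx ?s) \<le> h i" using i lt[OF s(1)] ready by blast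
      ultimately show "idx ?s \<le> i" using ord[of ?s t] t by auto
    qed
    moreover have "\<exists>i<n. x \<le> height h trim D i" using ready lt[OF s(1)] by blast
    ultimately show ?thesis using True by (simp add: fastest_choice_def leaf_code_def)
  next
    case False
    have "\<not> x \<le> height h trim D i" if i: "i < n" for i
    proof -
      obtain t where t: "t < n" "idx t = i" using surj[OF i] by blast
      then have "P + t \<in> {P..<l}" using False l by auto
      then show ?thesis using l(4) hx[OF t(1)] t(2) by fastforce
    qed
    then show ?thesis using False by (simp add: fastest_choice_def leaf_code_def)
  qed
qed

lemma oracle_correct:
  assumes h: "\<And>i. i < n \<Longrightarrow> h i = real (p i) / real (q i)" and x: "x = real xp / real xq"
    and m: "mem s0 0 = n" "mem s0 1 = xp" "mem s0 2 = xq" "input_mem (mem s0)" "\<forall>a\<ge>A. mem s0 a = 0"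
  defines "build \<equiv> compile 0 build_com" and "query \<equiv> compile 0 query_com"
  shows "\<exists>tb tq s. oracle_run W build query s0 tb tq s \<and>
    reduce_fastest n h x (oracle_schedule s) \<and>
    oracle_cells W build query s0 tb tq s \<subseteq> {..<M} \<and>
    tb \<le> 40 + 3 * k + 42 * P + n * (52 + 14 * k) \<and> (\<forall>D. tq D \<le> 28 + 37 * k)"
proof -
  have "wp W M build_com (40 + 3 * k + 42 * P + n * (52 + 14 * k))
    (\<lambda>R' m'. \<exists>idx. sorted_upto n idx \<and> base_regs W P A 0 R' \<and>
       tree_mem W P A (\<lambda>l. leaf_wait idx l + P) m' \<and> tables P A (leaf_code idx) (leaf_wait idx) m') (regs s0) (mem s0)"
    by (rule wp_build[OF m]) blast+
  then obtain tb sb where tb: "tb \<le> 40 + 3 * k + 42 * P + n * (52 + 14 * k)"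
    "runs W build s0 tb sb" "accessed_cells W build s0 tb \<subseteq> {..<M}"
    and "\<exists>idx. sorted_upto n idx \<and> base_regs W P A 0 (regs sb) \<and>
       tree_mem W P A (\<lambda>l. leaf_wait idx l + P) (mem sb) \<and> tables P A (leaf_code idx) (leaf_wait idx) (mem sb)"
    unfolding build_def by (rule wp_runs) blast
  then obtain idx where srt: "sorted_upto n idx" and sb: "base_regs W P A 0 (regs sb)"
       "tree_mem W P A (\<lambda>l. leaf_wait idx l + P) (mem sb)" "tables P A (leaf_code idx) (leaf_wait idx) (mem sb)"
    by blast
  \<comment> \<open>The state of the machine is paired with two ghost components: \<open>L\<close>,
    the day after the last trimming of each leaf, and \<open>f\<close>, the unbounded keys. The
    clause for day 0 ties the chosen sequence to the result of the build program.\<close>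
  define Inv where "Inv D y \<longleftrightarrow> (case y of (s, L, f) \<Rightarrow>
     base_regs W P A D (regs s) \<and> tree_mem W P A f (mem s) \<and> tables P A (leaf_code idx) (leaf_wait idx) (mem s) \<and>
     keys_ok P (leaf_wait idx) D f \<and> sched_ok P (leaf_wait idx) L D f \<and> (D = 0 \<longrightarrow> s = sb \<and> L = (\<lambda>_. 0)))"
    for D and y :: "config \<times> (nat \<Rightarrow> nat) \<times> (nat \<Rightarrow> nat)"
  define Step where "Step D y y' \<longleftrightarrow> (case y of (s, L, f) \<Rightarrow> case y' of (s', L', f') \<Rightarrow>
     (\<exists>t\<le>28 + 37 * k. runs W query s t s' \<and> accessed_cells W query s t \<subseteq> {..<M}) \<and>
     (\<exists>l. P \<le> l \<and> l < 2 * P \<and> L l + leaf_wait idx l \<le> D \<and> (\<forall>i\<in>{P..<l}. D < L i + leaf_wait idx i) \<and>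
        regs s' 0 = leaf_code idx l \<and> L' = L(l := Suc D)))"
    for D and y y' :: "config \<times> (nat \<Rightarrow> nat) \<times> (nat \<Rightarrow> nat)"
  have init: "Inv 0 (sb, \<lambda>_. 0, \<lambda>l. leaf_wait idx l + P)"
  proof -
    have "keys_ok P (leaf_wait idx) 0 (\<lambda>l. leaf_wait idx l + P)"
      unfolding keys_ok_def
    proof (intro ballI conjI)
      fix l assume "l \<in> {P..<2 * P}"
      then show "\<exists>D'\<ge>0. D' mod P = l - P \<and> D' \<le> leaf_wait idx l + P"
        by (intro exI[of _ "l - P"]) auto
    qed simp
    then show ?thesis using sb by (simp add: Inv_def sched_ok_def)
  qed
  have step: "\<exists>y'. Inv (Suc D) y' \<and> Step D y y'" if "Inv D y" for D y
  proof -
    obtain s L f where y: "y = (s, L, f)" by (cases y)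
    have inv: "base_regs W P A D (regs s)" "tree_mem W P A f (mem s)"
      "tables P A (leaf_code idx) (leaf_wait idx) (mem s)" "keys_ok P (leaf_wait idx) D f" "sched_ok P (leaf_wait idx) L D f"
      using that by (simp_all add: Inv_def y)
    have pad: "P + n \<in> {P..<2 * P}" using nP by simp
    then have "L (P + n) + leaf_wait idx (P + n) \<le> D"
      using inv(5) by (simp add: sched_ok_def leaf_wait_def)
    then have ready: "\<exists>l\<in>{P..<2 * P}. f l \<le> D + P"
      using pad sched_ok_ready[OF inv(5) pad] by blast
    have "wp W M query_com (28 + 37 * k)
      (\<lambda>R' m'. \<exists>l. P \<le> l \<and> l < 2 * P \<and> f l \<le> D + P \<and> (\<forall>i\<in>{P..<l}. D + P < f i) \<and> R' 0 = leaf_code idx l \<and>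
         base_regs W P A (Suc D) R' \<and> tree_mem W P A (next_keys P (leaf_wait idx) D l f) m' \<and>
         tables P A (leaf_code idx) (leaf_wait idx) m' \<and> keys_ok P (leaf_wait idx) (Suc D) (next_keys P (leaf_wait idx) D l f))
      (regs s) (mem s)"
      by (rule wp_query[OF inv(1) P_pow _ _ inv(2,3,4) leaf_wait_small[OF srt] ready])
        (use layout M_less in \<open>auto\<close>)
    then obtain t s' where t: "t \<le> 28 + 37 * k" "runs W query s t s'"
      "accessed_cells W query s t \<subseteq> {..<M}" and
      "\<exists>l. P \<le> l \<and> l < 2 * P \<and> f l \<le> D + P \<and> (\<forall>i\<in>{P..<l}. D + P < f i) \<and> regs s' 0 = leaf_code idx l \<and>
         base_regs W P A (Suc D) (regs s') \<and> tree_mem W P A (next_keys P (leaf_wait idx) D l f) (mem s') \<and>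
         tables P A (leaf_code idx) (leaf_wait idx) (mem s') \<and> keys_ok P (leaf_wait idx) (Suc D) (next_keys P (leaf_wait idx) D l f)"
      unfolding query_def by (rule wp_runs) blast
    then obtain l where l: "P \<le> l" "l < 2 * P" "f l \<le> D + P" "\<forall>i\<in>{P..<l}. D + P < f i"
        "regs s' 0 = leaf_code idx l"
      and s': "base_regs W P A (Suc D) (regs s')" "tree_mem W P A (next_keys P (leaf_wait idx) D l f) (mem s')"
         "tables P A (leaf_code idx) (leaf_wait idx) (mem s')" "keys_ok P (leaf_wait idx) (Suc D) (next_keys P (leaf_wait idx) D l f)"
      by blast
    have rdy: "f i \<le> D + P \<longleftrightarrow> L i + leaf_wait idx i \<le> D" if "i \<in> {P..<2 * P}" for i
      by (rule sched_ok_ready[OF inv(5) that])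
    have "L l + leaf_wait idx l \<le> D" using rdy[of l] l by simp
    moreover have "\<forall>i\<in>{P..<l}. D < L i + leaf_wait idx i"
    proof
      fix i assume "i \<in> {P..<l}"
      then show "D < L i + leaf_wait idx i" using rdy[of i] l(2,4) by fastforce
    qed
    ultimately have "Step D y (s', L(l := Suc D), next_keys P (leaf_wait idx) D l f)"
      unfolding Step_def y using t l by auto
    moreover have "Inv (Suc D) (s', L(l := Suc D), next_keys P (leaf_wait idx) D l f)"
      using s' sched_ok_next[OF inv(5)] by (simp add: Inv_def)
    ultimately show ?thesis by blast
  qed
  \<comment> \<open>Correctness of a query gives only the existence of a next state, so the infinite
    run is assembled by dependent choice.\<close>
  obtain F where F: "\<And>D. Inv D (F D)" "\<And>D. Step D (F D) (F (Suc D))"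
    using dependent_nat_choice[of Inv Step] init step by blast
  define s where "s D = fst (F D)" for D
  define L where "L D = fst (snd (F D))" for D
  have s0: "s 0 = sb" "L 0 = (\<lambda>_. 0)"
    using F(1)[of 0] by (auto simp: Inv_def s_def L_def split: prod.splits)
  have run: "\<exists>t. t \<le> 28 + 37 * k \<and> runs W query (s D) t (s (Suc D)) \<and>
      accessed_cells W query (s D) t \<subseteq> {..<M}" for D
    using F(2)[of D] by (auto simp: Step_def s_def split: prod.splits)
  then obtain tq where tq: "\<And>D. tq D \<le> 28 + 37 * k" "\<And>D. runs W query (s D) (tq D) (s (Suc D))"
      "\<And>D. accessed_cells W query (s D) (tq D) \<subseteq> {..<M}"
    by metis
  define trim where "trim = oracle_schedule s"
  have lf: "\<exists>l. P \<le> l \<and> l < 2 * P \<and> L D l + leaf_wait idx l \<le> D \<and> (\<forall>i\<in>{P..<l}. D < L D i + leaf_wait idx i) \<and>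
      trim D = (if leaf_code idx l = 0 then None else Some (leaf_code idx l - 1)) \<and> L (Suc D) = (L D)(l := Suc D)" for D
    using F(2)[of D]
    by (auto simp: Step_def s_def L_def trim_def oracle_schedule_def answer_def split: prod.splits)
  have Lr: "L D (P + t) = last_reset trim D (idx t)" if "t < n" for D t
  proof (induction D)
    case 0
    then show ?case using s0 by simp
  next
    case (Suc D)
    obtain l where l: "P \<le> l" "l < 2 * P"
      "trim D = (if leaf_code idx l = 0 then None else Some (leaf_code idx l - 1))" "L (Suc D) = (L D)(l := Suc D)"
      using lf[of D] by blast
    \<comment> \<open>When a padding leaf is chosen, its answer is 0 and no bamboo is reset,
      although \<open>L\<close> changes at that leaf; otherwise injectivity of \<open>idx\<close>
      identifies the leaf.\<close>
    have "trim D = Some (idx t) \<longleftrightarrow> P + t = l"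
    proof
      assume "trim D = Some (idx t)"
      then have "l - P < n" "idx (l - P) = idx t" using l(3) by (auto simp: leaf_code_def split: if_splits)
      moreover have "inj_on idx {..<n}" using srt by (simp add: sorted_upto_def)
      ultimately have "l - P = t" using that by (metis inj_onD lessThan_iff)
      then show "P + t = l" using l(1) by simp
    next
      assume "P + t = l"
      then show "trim D = Some (idx t)" using l(3) that by (auto simp: leaf_code_def)
    qed
    then show ?case using Suc by (simp add: last_reset_Suc l(4))
  qed
  have "reduce_fastest n h x trim"
    unfolding reduce_fastest_def
  proof
    fix D
    obtain l where l: "P \<le> l" "l < 2 * P" "L D l + leaf_wait idx l \<le> D" "\<forall>i\<in>{P..<l}. D < L D i + leaf_wait idx i"
      "trim D = (if leaf_code idx l = 0 then None else Some (leaf_code idx l - 1))"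
      using lf[of D] by blast
    show "trim D = fastest_choice n h x (height h trim D)"
      unfolding l(5) by (rule fastest_choice_leaf[OF srt h x Lr l(1-4), symmetric])
  qed
  moreover have "oracle_run W build query s0 tb tq s"
    using tb tq s0 by (simp add: oracle_run_def)
  moreover have "oracle_cells W build query s0 tb tq s \<subseteq> {..<M}"
    using tb tq unfolding oracle_cells_def by blast
  ultimately show ?thesis using tb(1) tq(1) unfolding trim_def by blast
qed

end

section \<open>Input encoding and asymptotic bounds\<close>

lemma input_cells_length: "length (input_cells n ex eh) = 2 * n + 3"
proof -
  have "length (concat (map (\<lambda>i. [fst (eh i), snd (eh i)]) [0..<n])) = 2 * n"
    by (induction n) auto
  then show ?thesis by (simp add: input_cells_def)
qed

lemma input_cells_nth:
  assumes "i < n"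
  shows "input_cells n ex eh ! (i + i + 3) = fst (eh i)" "input_cells n ex eh ! (i + i + 3 + 1) = snd (eh i)"
proof -
  let ?c = "\<lambda>n. concat (map (\<lambda>i. [fst (eh i), snd (eh i)]) [0..<n])"
  have len: "length (?c n) = 2 * n" for n by (induction n) auto
  have "?c n ! (i + i) = fst (eh i) \<and> ?c n ! Suc (i + i) = snd (eh i)"
    using assms
  proof (induction n)
    case (Suc n)
    show ?case
    proof (cases "i = n")
      case True
      then show ?thesis using len[of n] by (simp add: nth_append mult_2)
    next
      case False
      then show ?thesis using Suc len[of n] by (simp add: nth_append mult_2)
    qed
  qed simp
  then show "input_cells n ex eh ! (i + i + 3) = fst (eh i)"
    "input_cells n ex eh ! (i + i + 3 + 1) = snd (eh i)"
    by (simp_all add: input_cells_def numeral_3_eq_3)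
qed

theorem theorem4:
  fixes c :: nat
  shows "\<exists>(K :: nat) (build :: prog) (query :: prog) (S :: nat \<Rightarrow> real) (B :: nat \<Rightarrow> real) (Q :: nat \<Rightarrow> real).
    c \<le> K \<and>
    S \<in> O(\<lambda>n. real n) \<and>
    B \<in> O(\<lambda>n. real n * ln (real n)) \<and>
    Q \<in> O(\<lambda>n. ln (real n)) \<and>
    (\<forall>(w :: nat) (n :: nat) (h :: nat \<Rightarrow> real) (x :: real) (ex :: nat \<times> nat) (eh :: nat \<Rightarrow> nat \<times> nat).
       0 < x \<longrightarrow>
       bgt_instance n h \<longrightarrow>
       n < 2 ^ (c * w) \<longrightarrow>
       represents (c * w) ex x \<longrightarrow>
       (\<forall>i<n. represents (c * w) (eh i) (h i)) \<longrightarrow>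
       fits (c * w) (x / Min (h ` {..<n})) \<longrightarrow>
       implements_reduce_fastest w K build query n h x (input_cells n ex eh) (S n) (B n) (Q n))"
proof -
  \<comment> \<open>With \<open>B = 2 ^ (c * w)\<close> the demand \<open>16 * B ^ 8\<close> equals
    \<open>2 ^ (8 * c * w + 4)\<close>, which is at most \<open>2 ^ (K * w)\<close> for positive
    \<open>w\<close>.\<close>
  define K where "K = 8 * c + 4"
  define build where "build = compile 0 build_com"
  define query where "query = compile 0 query_com"
  define r where "r = card (insert 0 (prog_regs build \<union> prog_regs query))"
  \<comment> \<open>The memory segment has \<open>2 * n + 3 + 4 * P\<close> cells with
    \<open>P \<le> 2 * n\<close>, hence at most \<open>10 * n + 3\<close>. For the times,
    \<open>k\<close> is at most \<open>1 + log 2 n\<close>; the resulting linear terms, and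
    \<open>3 * k \<le> 6 * n\<close>, are absorbed into 160, and 65 is
    \<open>28 + 37\<close>.\<close>
  define S where "S n = real (K * (r + 3)) + real (K * 10) * real n" for n
  define T where "T n = 40 + 160 * real n + 14 * (real n * log 2 (real n))" for n
  define Q where "Q n = 65 + 37 * log 2 (real n)" for n
  have S: "S \<in> O(\<lambda>n. real n)"
  proof -
    have "(\<lambda>n. real (K * (r + 3))) \<in> O(\<lambda>n. real n)" by real_asymp
    moreover have "(\<lambda>n. real (K * 10) * real n) \<in> O(\<lambda>n. real n)" by simp
    ultimately show ?thesis unfolding S_def[abs_def] by (rule sum_in_bigo)
  qed
  have T: "T \<in> O(\<lambda>n. real n * ln (real n))" unfolding T_def[abs_def] by real_asymp
  have Q: "Q \<in> O(\<lambda>n. ln (real n))" unfolding Q_def[abs_def] by real_asymp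
  have "implements_reduce_fastest w K build query n h x (input_cells n ex eh) (S n) (T n) (Q n)"
    if x0: "0 < x" and inst: "bgt_instance n h" and nw: "n < 2 ^ (c * w)"
      and rx: "represents (c * w) ex x" and rh: "\<forall>i<n. represents (c * w) (eh i) (h i)"
    for w n h x ex eh
  proof -
    let ?W = "K * w" and ?B = "2 ^ (c * w) :: nat"
    have n0: "0 < n" using inst by (cases n) (auto simp: bgt_instance_def)
    \<comment> \<open>For \<open>w = 0\<close> the bound on \<open>n\<close> would leave only
      \<open>n = 0\<close>, which contradicts that the rates sum to 1.\<close>
    have w0: "0 < w" using nw n0 by (cases w) auto
    obtain j where j: "2 ^ j \<le> n" "n < 2 ^ Suc j" using ex_power_ivl1[of 2 n] n0 by auto
    define k where "k = Suc j"
    have hi: "0 < fst (eh i) \<and> fst (eh i) < ?B \<and> 0 < snd (eh i) \<and> snd (eh i) < ?B \<and>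
        h i = real (fst (eh i)) / real (snd (eh i))" if "i < n" for i
    proof -
      have "represents (c * w) (eh i) (h i)" "0 < h i" using rh inst that by (auto simp: bgt_instance_def)
      then show ?thesis by (auto simp: represents_def zero_less_divide_iff)
    qed
    interpret garden ?W ?B n k "fst ex" "snd ex" "\<lambda>i. fst (eh i)" "\<lambda>i. snd (eh i)"
    proof
      show "0 < fst ex" using x0 rx by (auto simp: represents_def zero_less_divide_iff)
      show "fst ex < ?B" "0 < snd ex" "snd ex < ?B" using rx by (auto simp: represents_def)
      show "n < 2 ^ k" "2 ^ k \<le> 2 * n" using j by (simp_all add: k_def)
      have "16 * ?B ^ 8 = (2::nat) ^ (8 * (c * w) + 4)"
        by (simp add: power_add power_mult[symmetric] mult.commute)
      also have "\<dots> \<le> 2 ^ ?W"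
        using w0 by (intro power_increasing) (simp_all add: K_def algebra_simps)
      finally show "16 * ?B ^ 8 \<le> 2 ^ ?W" .
    qed (use n0 nw hi in auto)
    let ?s0 = "initial_config (input_cells n ex eh)"
    have cell: "mem ?s0 a = (if a < A then input_cells n ex eh ! a else 0)" for a
      by (simp add: initial_config_def input_cells_length A_def)
    have inp: "input_mem (mem ?s0)"
      unfolding input_mem_def cell using input_cells_nth by (auto simp: A_def simp del: One_nat_def)
    have m0: "mem ?s0 0 = n" "mem ?s0 1 = fst ex" "mem ?s0 2 = snd ex" "\<forall>a\<ge>A. mem ?s0 a = 0"
      unfolding cell by (simp_all add: A_def input_cells_def)
    have hh: "h i = real (fst (eh i)) / real (snd (eh i))" if "i < n" for i
      using hi[OF that] by blast
    have xx: "x = real (fst ex) / real (snd ex)" using rx by (simp add: represents_def)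
    obtain tb tq s where run: "oracle_run ?W build query ?s0 tb tq s"
      "reduce_fastest n h x (oracle_schedule s)"
      "oracle_cells ?W build query ?s0 tb tq s \<subseteq> {..<M}"
      "tb \<le> 40 + 3 * k + 42 * P + n * (52 + 14 * k)" "\<And>D. tq D \<le> 28 + 37 * k"
      using oracle_correct[OF hh xx m0(1-3) inp m0(4), folded build_def query_def] by blast
    have M: "M \<le> 10 * n + 3" using nP by (simp add: layout)
    have "{..<length (input_cells n ex eh)} \<union> oracle_cells ?W build query ?s0 tb tq s \<subseteq> {..<M}"
      using run(3) by (auto simp: input_cells_length layout)
    moreover have "real (K * (r + M)) \<le> S n"
    proof -
      have "K * (r + M) \<le> K * (r + 3) + K * 10 * n" using mult_le_mono2[OF M, of K] by (simp add: algebra_simps)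
      then show ?thesis unfolding S_def by (metis of_nat_add of_nat_le_iff of_nat_mult)
    qed
    ultimately have space: "space_at_most K build query (input_cells n ex eh)
        (oracle_cells ?W build query ?s0 tb tq s) (S n)"
      unfolding space_at_most_def r_def by blast
    have kl: "real k \<le> 1 + log 2 (real n)"
      using le_log_of_power[of 2 j "real n"] j(1) by (simp add: k_def numeral_power_le_of_nat_cancel_iff)
    have kn: "k \<le> 2 * n" using k(2) less_exp[of k] by linarith
    have "real tb \<le> T n"
    proof -
      have "tb \<le> 40 + 142 * n + 14 * (n * k)"
        using run(4) kn nP(2) by (simp add: algebra_simps)
      then have "real tb \<le> 40 + 142 * real n + 14 * (real n * real k)"
        by (metis (mono_tags, lifting) of_nat_add of_nat_le_iff of_nat_mult of_nat_numeral)
      also have "\<dots> \<le> 40 + 142 * real n + 14 * (real n * (1 + log 2 (real n)))"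
        using kl by (intro add_left_mono mult_left_mono) auto
      also have "\<dots> \<le> T n" by (simp add: T_def algebra_simps)
      finally show ?thesis .
    qed
    moreover have "real (tq D) \<le> Q n" for D
      using run(5)[of D] kl by (simp add: Q_def)
    ultimately show ?thesis
      unfolding implements_reduce_fastest_def using run(1,2) space by blast
  qed
  moreover have "c \<le> K" by (simp add: K_def)
  ultimately show ?thesis using S T Q by blast
qed

end
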